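(* Suppose $V>c_0>c_1>v$ and let $X(0)=x$ with $x\in(b_0,a_0)$. Then the probabilities $p_i(x)=\mathbb{P}\{\mathscr{T}(x,a_0)<\infty\mid \xi(0)=i\}$, $i\in\{0,1\}$, have the form $$p_0(x)=1-B_0^{-1}\int_x^{a_0}\frac{\exp\left(\lambda_0\Phi_0(y)+\lambda_1\Phi_1(y)\right)}{c_0-U'(y)}\,dy,$$ $$p_1(x)=B_1^{-1}\int_{b_0}^x\frac{\exp\left(\lambda_0\Phi_0(y)+\lambda_1\Phi_1(y)\right)}{c_1-U'(y)}\,dy,$$ where $$B_i=\int_{b_0}^{a_0}\frac{\exp\left(\lambda_0\Phi_0(y)+\lambda_1\Phi_1(y)\right)}{c_i-U'(y)}\,dy,\qquad i\in\{0,1\}.$$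
   Context: Let $U\in C^2(-\infty,\infty)$ be a double-well potential: it has a local maximum at $x_0$ and two local minima at $x_-,x_+$ with $x_-<x_0<x_+$, and $U''\neq0$ at these points. Let $c_0>c_1$ be real, and let $\xi=\xi(t)\in\{0,1\}$ be a two-state Markov process which switches from $0$ to $1$ with intensity $\lambda_0>0$ and from $1$ to $0$ with intensity $\lambda_1>0$. The process $X=X^x(t)$ solves $dX(t)=\left(c_{\xi(t)}-U'(X(t))\right)dt$, $t>0$, $X(0)=x$. Set $U_i(x)=U(x)-c_ix$; it is assumed that $\int\frac{dy}{U_i'(y)}$ diverges at every critical point of $U_i$. $V$ and $v$ denote, respectively, the local maximum value and the local minimum value of $U'$. When $V>c_0>c_1>v$, both $U_0$ and $U_1$ are double-well potentials; $a_-<a_0<a_+$ denote the critical points of $U_1$ (i.e. the solutions of $U'=c_1$) and $b_-<b_0<b_+$ the critical points of $U_0$ (the solutions of $U'=c_0$), with $a_-<b_-<b_0<a_0<a_+<b_+$. $\mathscr{T}(x,y)=\inf\{t>0: X(t)=y\}$ for the process started from $X(0)=x$ (with value $\infty$ if the set is empty). The functions $\Phi_0,\Phi_1$ are defined on $(b_0,a_0)$, up to arbitrary additive constants (the same fixed choice being used throughout), by $\Phi_i'(y)=\frac{1}{c_i-U'(y)}$. *)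

theory Defs
  imports "HOL-Probability.Probability"
begin

definition C2 :: "(real \<Rightarrow> real) \<Rightarrow> bool" where
  "C2 f \<longleftrightarrow> (\<forall>y. f differentiable (at y)) \<and> (\<forall>y. deriv f differentiable (at y))
     \<and> continuous_on UNIV (deriv (deriv f))"

definition local_max_at :: "(real \<Rightarrow> real) \<Rightarrow> real \<Rightarrow> bool" where
  "local_max_at f z \<longleftrightarrow> (\<forall>\<^sub>F y in nhds z. f y \<le> f z)"

definition local_min_at :: "(real \<Rightarrow> real) \<Rightarrow> real \<Rightarrow> bool" where
  "local_min_at f z \<longleftrightarrow> (\<forall>\<^sub>F y in nhds z. f z \<le> f y)"

definition double_well :: "(real \<Rightarrow> real) \<Rightarrow> real \<Rightarrow> real \<Rightarrow> real \<Rightarrow> bool" where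
  "double_well U xm x0 xp \<longleftrightarrow> C2 U \<and> xm < x0 \<and> x0 < xp
     \<and> local_min_at U xm \<and> local_max_at U x0 \<and> local_min_at U xp
     \<and> (\<forall>z\<in>{xm, x0, xp}. deriv (deriv U) z \<noteq> 0)"

text \<open>The integral of \<open>1 / \<bar>f\<bar>\<close> diverges on each one-sided neighbourhood of \<open>z\<close>.  In \<^typ>\<open>ennreal\<close>,
  \<open>inverse 0 = \<infinity>\<close>, so zeros of \<open>f\<close> are treated as singularities.\<close>

definition reciprocal_integral_diverges_at :: "(real \<Rightarrow> real) \<Rightarrow> real \<Rightarrow> bool" where
  "reciprocal_integral_diverges_at f z \<longleftrightarrow> (\<forall>e>0.
     (\<integral>\<^sup>+ y\<in>{z<..<z + e}. inverse (ennreal \<bar>f y\<bar>) \<partial>lborel) = \<infinity> \<and>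
     (\<integral>\<^sup>+ y\<in>{z - e<..<z}. inverse (ennreal \<bar>f y\<bar>) \<partial>lborel) = \<infinity>)"

text \<open>A time-homogeneous Markov jump process on the states 0 and 1 with transition
  function \<open>p\<close>, which leaves state \<open>i\<close> with intensity \<open>l i\<close>, that is,
  \<open>p i (1 - i) h = l i * h + o(h)\<close> as \<open>h\<close> tends to 0 from the right.  Paths are right-continuous
  with left limits, hence have finitely many switches in bounded time.  No initial distribution
  is prescribed.\<close>

definition two_state_markov ::
    "'w measure \<Rightarrow> (real \<Rightarrow> 'w \<Rightarrow> nat) \<Rightarrow> (nat \<Rightarrow> real) \<Rightarrow> bool" where
  "two_state_markov M \<xi> l \<longleftrightarrow>
     (\<forall>t\<ge>0. \<xi> t \<in> measurable M (count_space UNIV)) \<and>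
     (\<forall>t\<ge>0. \<forall>\<omega>\<in>space M. \<xi> t \<omega> \<in> {0, 1}) \<and>
     (\<forall>\<omega>\<in>space M. \<forall>t\<ge>0. \<forall>\<^sub>F s in at_right t. \<xi> s \<omega> = \<xi> t \<omega>) \<and>
     (\<forall>\<omega>\<in>space M. \<forall>t>0. \<exists>j. \<forall>\<^sub>F s in at_left t. \<xi> s \<omega> = j) \<and>
     (\<exists>p :: nat \<Rightarrow> nat \<Rightarrow> real \<Rightarrow> real.
        (\<forall>i\<in>{0, 1}. \<forall>h\<ge>0. p i 0 h \<ge> 0 \<and> p i 1 h \<ge> 0 \<and> p i 0 h + p i 1 h = 1) \<and>
        (\<forall>(n::nat) (t :: nat \<Rightarrow> real) (s :: nat \<Rightarrow> nat) h. \<forall>j\<in>{0, 1}.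
           0 \<le> t 0 \<and> (\<forall>k<n. t k < t (Suc k)) \<and> h \<ge> 0 \<and>
           \<P>(\<omega> in M. \<forall>k\<le>n. \<xi> (t k) \<omega> = s k) > 0 \<longrightarrow>
           \<P>(\<omega> in M. \<xi> (t n + h) \<omega> = j \<bar> \<forall>k\<le>n. \<xi> (t k) \<omega> = s k) = p (s n) j h) \<and>
        (\<forall>i\<in>{0, 1}. ((\<lambda>h. p i (1 - i) h / h) \<longlongrightarrow> l i) (at_right 0)))"

text \<open>The equation \<open>dX(t) = (c\<^bsub>\<xi>(t)\<^esub> - U'(X(t))) dt\<close>, \<open>X(0) = x\<close>, in integrated form, since
  \<open>X\<close> is not differentiable at the switching times.\<close>

definition solves_switched_ode ::
    "'w measure \<Rightarrow> (real \<Rightarrow> 'w \<Rightarrow> nat) \<Rightarrow> (nat \<Rightarrow> real) \<Rightarrow> (real \<Rightarrow> real) \<Rightarrow> real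
      \<Rightarrow> (real \<Rightarrow> 'w \<Rightarrow> real) \<Rightarrow> bool" where
  "solves_switched_ode M \<xi> c U x X \<longleftrightarrow>
     (\<forall>t\<ge>0. X t \<in> borel_measurable M) \<and>
     (\<forall>\<omega>\<in>space M. \<forall>t\<ge>0.
        ((\<lambda>s. c (\<xi> s \<omega>) - deriv U (X s \<omega>)) has_integral (X t \<omega> - x)) {0..t})"

definition hitting_time :: "(real \<Rightarrow> 'w \<Rightarrow> real) \<Rightarrow> real \<Rightarrow> 'w \<Rightarrow> ereal" where
  "hitting_time X y \<omega> = Inf (ereal ` {t. t > 0 \<and> X t \<omega> = y})"

end

theory Submission
  imports Defs
begin

text \<open>
  Write \<open>\<alpha> = b0\<close>, \<open>\<beta> = a0\<close>.  Between these points the drift \<open>c 0 - U'\<close> is positive and the drift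
  \<open>c 1 - U'\<close> is negative; the first vanishes at \<open>\<alpha>\<close>, the second at \<open>\<beta>\<close>.  The path can therefore leave
  \<open>(\<alpha>, \<beta>)\<close> only through \<open>\<beta>\<close> in state 0 or through \<open>\<alpha>\<close> in state 1, and after leaving through \<open>\<alpha>\<close> it
  never rises above \<open>\<alpha>\<close> again.  So \<open>\<beta>\<close> is hit exactly when the path leaves through \<open>\<beta>\<close>, and nothing
  changes if \<open>U'\<close> is replaced by the function \<open>W\<close> that equals \<open>U'\<close> on \<open>[\<alpha>, \<beta>]\<close> and is constant on either
  side (\<open>ex_clamped_path\<close>).  \<open>W\<close> is bounded and globally Lipschitz.

  Let \<open>F = exp (l 0 * \<Phi> 0 + l 1 * \<Phi> 1)\<close>.  The functions in the theorem, continued by 0 to the left of \<open>\<alpha>\<close>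
  and by 1 to the right of \<open>\<beta>\<close>, solve the backward equations
  \<open>(c i - W) * u i' = l i * (u i - u (1 - i))\<close>.  The reason is that \<open>F' = l 0 * f 0 + l 1 * f 1\<close> for the
  integrands \<open>f i = F / (c i - U')\<close>, and that \<open>F\<close> vanishes at both ends: integration gives
  \<open>l 0 * B 0 + l 1 * B 1 = 0\<close> and then \<open>l 0 * B 0 * (u 0 - u 1) = F\<close> (\<open>ex_exit_function\<close>).  Hence
  \<open>u (\<xi> t) (Z t)\<close> is a martingale for the clamped path \<open>Z\<close>, and its expectation at time \<open>T\<close>, given
  \<open>\<xi> 0 = i\<close>, is \<open>u i x\<close>.

  The martingale identity is proved in discrete time.  The Euler scheme with step \<open>h\<close> is a function
  of \<open>\<xi>\<close> at the times \<open>k * h\<close>, so the finite-dimensional form of the Markov property turns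
  expectations along the scheme into powers of an explicit averaging operator
  (\<open>expectation_scheme\<close>).  By the backward equations one application of this operator changes \<open>u\<close> by
  \<open>o(h)\<close> uniformly (\<open>one_step_generator\<close>), hence \<open>T / h\<close> applications change it by \<open>o(1)\<close>.  As each path
  of \<open>\<xi>\<close> has finitely many switches up to time \<open>T\<close>, the scheme converges to \<open>Z T\<close> along every path
  (\<open>euler_converges\<close>), and dominated convergence gives the identity (\<open>expectation_exit_function\<close>).

  Finally, \<open>C - exp (2 * l i * \<Phi> i)\<close> is a strict supersolution of the same equations on \<open>[\<alpha>, \<beta>]\<close>, so the
  probability to be still inside at time \<open>T\<close> decays exponentially (\<open>survival_probability_le\<close>).  Since
  \<open>u\<close> is 1 on the right of the interval and 0 on its left, the limit \<open>T \<rightarrow> \<infinity>\<close> identifies \<open>u i x\<close> as the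
  probability to leave through \<open>\<beta>\<close> (\<open>exit_probability\<close>).
\<close>

section \<open>Euler steps and exponentials near an equilibrium\<close>

text \<open>
  An Euler step is compared with the tangent direction although \<open>u'\<close> may be unbounded near a zero of
  \<open>b\<close>.  Along the step from \<open>y\<close> to \<open>y + h * b y\<close> the Lipschitz bound keeps \<open>b\<close> comparable to \<open>b y\<close>, so the
  segment contains no zero of \<open>b\<close>, and only the product \<open>g = b * u'\<close> enters the estimate.
\<close>
lemma euler_increment:
  fixes b u g :: "real \<Rightarrow> real"
  assumes lip: "\<And>y z. \<bar>b y - b z\<bar> \<le> L * \<bar>y - z\<bar>"
    and du: "\<And>y. b y \<noteq> 0 \<Longrightarrow> (u has_real_derivative g y / b y) (at y)"
    and g0: "\<And>y. b y = 0 \<Longrightarrow> g y = 0"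
    and g: "continuous_on UNIV g"
    and "\<epsilon> > 0"
  shows "\<forall>\<^sub>F h in at_right 0. \<forall>y\<in>{p..q}. \<bar>u (y + h * b y) - u y - h * g y\<bar> \<le> \<epsilon> * h"
proof -
  have L0: "L \<ge> 0"
    using lip[of 0 1] by simp
  have contb: "continuous_on UNIV b"
    by (rule lipschitz_on_continuous_on[of L]) (use lip L0 in \<open>auto simp: lipschitz_on_def dist_real_def\<close>)
  obtain K where K: "K > 0" "\<And>y. y \<in> {p..q} \<Longrightarrow> \<bar>b y\<bar> \<le> K"
  proof -
    have "bounded (b ` {p..q})"
      by (intro compact_imp_bounded compact_continuous_image continuous_on_subset[OF contb]) auto
    then show ?thesis using that by (auto simp: bounded_pos)
  qed
  let ?N = "{p - 1..q + 1}"
  obtain G where G: "G > 0" "\<And>y. y \<in> ?N \<Longrightarrow> \<bar>g y\<bar> \<le> G"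
  proof -
    have "bounded (g ` ?N)"
      by (intro compact_imp_bounded compact_continuous_image continuous_on_subset[OF g]) auto
    then show ?thesis using that by (auto simp: bounded_pos)
  qed
  have "uniformly_continuous_on ?N g"
    by (intro compact_uniformly_continuous continuous_on_subset[OF g]) auto
  then obtain d where d: "d > 0"
      "\<And>y z. y \<in> ?N \<Longrightarrow> z \<in> ?N \<Longrightarrow> \<bar>z - y\<bar> < d \<Longrightarrow> \<bar>g z - g y\<bar> < \<epsilon> / 2"
    using \<open>\<epsilon> > 0\<close> unfolding uniformly_continuous_on_def dist_real_def
    by (metis half_gt_zero)
  define \<delta> where "\<delta> = Min {d / K, 1 / K, 1 / (2 * (L + 1)), \<epsilon> / (4 * G * (L + 1))}"
  have \<delta>: "\<delta> > 0" "\<delta> \<le> d / K" "\<delta> \<le> 1 / K" "\<delta> \<le> 1 / (2 * (L + 1))" "\<delta> \<le> \<epsilon> / (4 * G * (L + 1))"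
    unfolding \<delta>_def using d K G L0 \<open>\<epsilon> > 0\<close> by auto
  have "\<bar>u (y + h * b y) - u y - h * g y\<bar> \<le> \<epsilon> * h" if h: "0 < h" "h < \<delta>" and y: "y \<in> {p..q}" for h y
  proof (cases "b y = 0")
    case True
    then show ?thesis using g0 h \<open>\<epsilon> > 0\<close> by simp
  next
    case False
    have hd: "h * K < d" "h * K < 1" "h * (L + 1) < 1 / 2"
      using less_le_trans[OF h(2) \<delta>(2)] less_le_trans[OF h(2) \<delta>(3)] less_le_trans[OF h(2) \<delta>(4)] K L0
      by (simp_all add: field_simps)
    have hd4: "h * (L + 1) * G < \<epsilon> / 4"
    proof -
      have "0 < 4 * G * (L + 1)" using G L0 by simp
      then have "h * (4 * G * (L + 1)) < \<epsilon>"
        using less_le_trans[OF h(2) \<delta>(5)] by (metis pos_less_divide_eq)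
      then show ?thesis by (simp add: mult_ac)
    qed
    have Lh: "L * h < 1 / 2"
      using hd(3) h(1) by (simp add: algebra_simps)
    have close: "\<bar>b (y + r * b y) - b y\<bar> \<le> L * h * \<bar>b y\<bar>" if r: "0 \<le> r" "r \<le> h" for r
    proof -
      have "\<bar>b (y + r * b y) - b y\<bar> \<le> L * (r * \<bar>b y\<bar>)"
        using lip[of "y + r * b y" y] r by (simp add: abs_mult)
      also have "\<dots> \<le> L * (h * \<bar>b y\<bar>)"
        using r L0 by (intro mult_left_mono mult_right_mono) auto
      finally show ?thesis by (simp add: mult.assoc)
    qed
    have low: "\<bar>b (y + r * b y)\<bar> \<ge> \<bar>b y\<bar> / 2" if r: "0 \<le> r" "r \<le> h" for r
    proof -
      have "L * h * \<bar>b y\<bar> \<le> 1 / 2 * \<bar>b y\<bar>"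
        using Lh by (intro mult_right_mono) auto
      then show ?thesis using close[OF r] by linarith
    qed
    have nz: "b (y + r * b y) \<noteq> 0" if r: "0 \<le> r" "r \<le> h" for r
      using low[OF r] False by auto
    have "\<exists>r>0. r < h \<and> u (y + h * b y) - u (y + 0 * b y)
            = (h - 0) * (g (y + r * b y) / b (y + r * b y) * b y)"
    proof (rule MVT2)
      fix r assume "0 \<le> r" "r \<le> h"
      then show "((\<lambda>r. u (y + r * b y)) has_real_derivative
          g (y + r * b y) / b (y + r * b y) * b y) (at r)"
        by (intro DERIV_chain'[where f = "\<lambda>r. y + r * b y" and g = u] du nz)
           (auto intro!: derivative_eq_intros)
    qed (use h in auto)
    then obtain r where r: "0 < r" "r < h"
      and eq: "u (y + h * b y) - u y = h * (g (y + r * b y) / b (y + r * b y) * b y)"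
      by auto
    define z where "z = y + r * b y"
    have bz: "b z \<noteq> 0" "\<bar>b z\<bar> \<ge> \<bar>b y\<bar> / 2" "\<bar>b z - b y\<bar> \<le> L * h * \<bar>b y\<bar>"
      unfolding z_def using nz low close r by auto
    have "\<bar>z - y\<bar> \<le> h * K"
      unfolding z_def using r K(2)[OF y] by (auto simp: abs_mult intro!: mult_mono)
    then have zy: "\<bar>z - y\<bar> < d" "z \<in> ?N" "y \<in> ?N"
      using hd y by auto
    have "\<bar>g z / b z * b y - g y\<bar> \<le> \<bar>g z - g y\<bar> + \<bar>g z\<bar> * (\<bar>b y - b z\<bar> / \<bar>b z\<bar>)"
    proof -
      have "g z / b z * b y - g y = (g z - g y) + g z * ((b y - b z) / b z)"
        using bz(1) by (simp add: field_simps)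
      then show ?thesis
        by (metis abs_divide abs_mult abs_triangle_ineq)
    qed
    also have "\<dots> \<le> \<bar>g z - g y\<bar> + \<bar>g z\<bar> * (2 * L * h)"
    proof (intro add_left_mono mult_left_mono)
      have "\<bar>b y - b z\<bar> \<le> L * h * (2 * \<bar>b z\<bar>)"
        using bz(2,3) L0 h mult_left_mono[of "\<bar>b y\<bar>" "2 * \<bar>b z\<bar>" "L * h"] by auto
      then show "\<bar>b y - b z\<bar> / \<bar>b z\<bar> \<le> 2 * L * h" using bz(1) by (simp add: field_simps)
    qed simp
    also have "\<bar>g z - g y\<bar> + \<bar>g z\<bar> * (2 * L * h) \<le> \<epsilon> / 2 + G * (2 * L * h)"
      using d(2)[OF zy(3,2,1)] G(2)[OF zy(2)] L0 h by (intro add_mono mult_right_mono) auto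
    also have "\<dots> \<le> \<epsilon>"
    proof -
      have "h * L * G \<le> h * (L + 1) * G"
        using h G by (intro mult_right_mono mult_left_mono) auto
      then show ?thesis using hd4 by (simp add: algebra_simps)
    qed
    finally have "\<bar>g z / b z * b y - g y\<bar> \<le> \<epsilon>" by simp
    then have "h * \<bar>g z / b z * b y - g y\<bar> \<le> h * \<epsilon>"
      using h by (intro mult_left_mono) auto
    moreover have "u (y + h * b y) - u y - h * g y = h * (g z / b z * b y - g y)"
      using eq unfolding z_def by (simp add: algebra_simps)
    ultimately show ?thesis
      using h by (simp add: abs_mult mult.commute)
  qed
  then show ?thesis
    using \<delta>(1) unfolding eventually_at_right_field by blast
qed

text \<open>
  A Lipschitz drift grows at most linearly away from its zero \<open>p\<close>, so \<open>\<Phi> y \<le> ln (y - p) / L + const\<close> near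
  \<open>p\<close>.  Hence \<open>exp (\<mu> * \<Phi>)\<close> is bounded by a positive power of \<open>y - p\<close> and continues by 0.
\<close>
lemma exp_antiderivative_extension:
  fixes b \<Phi> :: "real \<Rightarrow> real"
  assumes lip: "\<And>y z. \<bar>b y - b z\<bar> \<le> L * \<bar>y - z\<bar>"
    and b0: "b p = 0" and bpos: "\<And>y. y > p \<Longrightarrow> b y > 0"
    and "\<mu> > 0" "p < q"
    and \<Phi>: "\<And>y. y \<in> {p<..<q} \<Longrightarrow> (\<Phi> has_real_derivative 1 / b y) (at y)"
  obtains E where "continuous_on UNIV E" "\<And>y. y \<le> p \<Longrightarrow> E y = 0" "\<And>y. y > p \<Longrightarrow> E y > 0"
    "\<And>y. y > p \<Longrightarrow> (E has_real_derivative \<mu> * E y / b y) (at y)"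
    "\<And>y. y \<in> {p<..<q} \<Longrightarrow> E y = exp (\<mu> * \<Phi> y)"
proof -
  have "\<bar>b (p + 1) - b p\<bar> \<le> L" using lip[of "p + 1" p] by simp
  then have L: "L > 0" using bpos[of "p + 1"] b0 by auto
  have contb: "continuous_on UNIV b"
    by (rule lipschitz_on_continuous_on[of L]) (use lip L in \<open>auto simp: lipschitz_on_def dist_real_def\<close>)
  have "\<exists>\<Psi>. \<forall>y::real. ereal p < y \<longrightarrow> y < \<infinity> \<longrightarrow> (\<Psi> has_vector_derivative 1 / b y) (at y)"
  proof (rule einterval_antiderivative)
    fix y :: real assume "ereal p < y" "y < \<infinity>"
    then have "y > p" by auto
    then show "isCont (\<lambda>y. 1 / b y) y"
      using contb bpos[of y] by (intro continuous_divide) (simp_all add: continuous_on_eq_continuous_at)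
  qed auto
  then obtain \<Psi> where \<Psi>: "\<And>y. y > p \<Longrightarrow> (\<Psi> has_real_derivative 1 / b y) (at y)"
    by (auto simp: has_real_derivative_iff_has_vector_derivative)
  have "\<exists>k. \<forall>y\<in>{p<..<q}. \<Phi> y - \<Psi> y = k"
  proof -
    have "(\<lambda>y. \<Phi> y - \<Psi> y) constant_on {p<..<q}"
    proof (rule has_field_derivative_0_imp_constant_on)
      show "((\<lambda>y. \<Phi> y - \<Psi> y) has_field_derivative 0) (at z)" if "z \<in> {p<..<q}" for z
        using DERIV_diff[OF \<Phi>[OF that] \<Psi>[of z]] that by auto
    qed auto
    then show ?thesis by (auto simp: constant_on_def)
  qed
  then obtain k where k: "\<And>y. y \<in> {p<..<q} \<Longrightarrow> \<Phi> y = \<Psi> y + k" by (metis diff_add_cancel add.commute)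
  define E where "E y = (if y \<le> p then 0 else exp (\<mu> * (\<Psi> y + k)))" for y
  have dE: "(E has_real_derivative \<mu> * E y / b y) (at y)" if "y > p" for y
  proof -
    have "((\<lambda>y. exp (\<mu> * (\<Psi> y + k))) has_real_derivative \<mu> * E y / b y) (at y)"
      using that by (auto intro!: derivative_eq_intros \<Psi> simp: E_def)
    then show ?thesis
    proof (rule has_field_derivative_transform_within_open[of _ _ _ "{p<..}"])
      show "\<And>x. x \<in> {p<..} \<Longrightarrow> exp (\<mu> * (\<Psi> x + k)) = E x"
        by (simp add: E_def)
    qed (use that in auto)
  qed
  define m where "m = p + 1"
  have bound: "E y \<le> E m * (y - p) powr (\<mu> / L)" if y: "p < y" "y \<le> m" for y
  proof -
    \<comment> \<open>\<open>\<Psi> - ln (y - p) / L\<close> increases because \<open>b z \<le> L * (z - p)\<close>\<close>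
    have incr: "\<exists>D. ((\<lambda>y. \<Psi> y - ln (y - p) / L) has_real_derivative D) (at z) \<and> D \<ge> 0"
      if "y \<le> z" for z
    proof -
      have "z > p" using y that by auto
      have "((\<lambda>y. \<Psi> y - ln (y - p) / L) has_real_derivative 1 / b z - 1 / (z - p) / L) (at z)"
        using \<open>z > p\<close> L by (auto intro!: derivative_eq_intros \<Psi>)
      moreover have "b z \<le> L * (z - p)"
        using lip[of z p] b0 \<open>z > p\<close> by auto
      then have "1 / b z - 1 / (z - p) / L \<ge> 0"
        using \<open>z > p\<close> bpos[of z] L by (simp add: divide_simps mult_ac)
      ultimately show ?thesis by blast
    qed
    have "\<Psi> y - ln (y - p) / L \<le> \<Psi> m - ln (m - p) / L"
      by (rule DERIV_nonneg_imp_nondecreasing[OF y(2)]) (rule incr)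
    then have "\<Psi> y \<le> \<Psi> m + ln (y - p) / L" by (simp add: m_def)
    then have "\<mu> * (\<Psi> y + k) \<le> \<mu> * (\<Psi> m + k) + ln (y - p) * (\<mu> / L)"
      using mult_left_mono[of "\<Psi> y" "\<Psi> m + ln (y - p) / L" \<mu>] \<open>\<mu> > 0\<close> by (simp add: algebra_simps)
    then have "exp (\<mu> * (\<Psi> y + k)) \<le> exp (\<mu> * (\<Psi> m + k)) * exp (ln (y - p) * (\<mu> / L))"
      by (metis exp_add exp_le_cancel_iff)
    then show ?thesis
      using y by (simp add: E_def m_def powr_def mult.commute)
  qed
  have "isCont E y" for y
  proof -
    consider "y < p" | "y = p" | "y > p" by linarith
    then show ?thesis
    proof cases
      case 1
      have "\<forall>\<^sub>F z in nhds y. E z = 0"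
        using eventually_nhds_in_open[of "{..<p}" y] 1
        by (auto elim!: eventually_mono simp: E_def)
      then show ?thesis by (subst isCont_cong) auto
    next
      case 2
      have "(E \<longlongrightarrow> 0) (at p)"
      proof (rule real_tendsto_sandwich[of "\<lambda>_. 0" _ _ "\<lambda>y. E m * \<bar>y - p\<bar> powr (\<mu> / L)"])
        have "\<forall>\<^sub>F z in at p. z < m"
          by (rule order_tendstoD(2)[OF tendsto_ident_at]) (simp add: m_def)
        then show "\<forall>\<^sub>F z in at p. E z \<le> E m * \<bar>z - p\<bar> powr (\<mu> / L)"
        proof eventually_elim
          case (elim z)
          have "E m \<ge> 0" by (simp add: E_def)
          then show ?case using bound[of z] elim by (cases "z \<le> p") (auto simp: E_def)
        qed
        have "((\<lambda>y. \<bar>y - p\<bar> powr (\<mu> / L)) \<longlongrightarrow> \<bar>p - p\<bar> powr (\<mu> / L)) (at p)"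
        proof (rule tendsto_powr')
          show "((\<lambda>y. \<bar>y - p\<bar>) \<longlongrightarrow> \<bar>p - p\<bar>) (at p)" by (intro tendsto_intros)
        qed (use \<open>\<mu> > 0\<close> L in auto)
        then show "((\<lambda>y. E m * \<bar>y - p\<bar> powr (\<mu> / L)) \<longlongrightarrow> 0) (at p)"
          by (auto intro!: tendsto_mult_right_zero)
      qed (auto simp: E_def)
      then show ?thesis using 2 by (simp add: isCont_def E_def)
    next
      case 3
      then show ?thesis using dE DERIV_isCont by blast
    qed
  qed
  then have "continuous_on UNIV E" by (simp add: continuous_at_imp_continuous_on)
  moreover have "E y = exp (\<mu> * \<Phi> y)" if "y \<in> {p<..<q}" for y
    using that k[OF that] by (simp add: E_def)
  ultimately show ?thesis
    using that[of E] dE by (auto simp: E_def)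
qed

section \<open>Two opposing drifts and the backward equations\<close>

text \<open>
  \<open>W\<close> plays the role of \<open>U'\<close>, made constant outside \<open>[\<alpha>, \<beta>]\<close>: there the two drifts never point back
  into the interval.
\<close>
locale opposing_drifts =
  fixes W :: "real \<Rightarrow> real" and c l :: "nat \<Rightarrow> real" and L \<alpha> \<beta> :: real
  assumes W_lipschitz: "\<bar>W y - W z\<bar> \<le> L * \<bar>y - z\<bar>"
    and ends: "\<alpha> < \<beta>"
    and W_left: "y \<le> \<alpha> \<Longrightarrow> W y = c 0"
    and W_right: "\<beta> \<le> y \<Longrightarrow> W y = c 1"
    and W_between: "\<alpha> < y \<Longrightarrow> y < \<beta> \<Longrightarrow> c 1 < W y \<and> W y < c 0"
    and rates: "l 0 > 0" "l 1 > 0"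
begin

definition drift :: "nat \<Rightarrow> real \<Rightarrow> real" where
  "drift i y = c i - W y"

lemma c_order: "c 1 < c 0"
  using W_between[of "(\<alpha> + \<beta>) / 2"] ends by auto

lemma drift_lipschitz: "\<bar>drift i y - drift i z\<bar> \<le> L * \<bar>y - z\<bar>"
  using W_lipschitz[of z y] by (simp add: drift_def abs_minus_commute)

lemma L_nonneg: "L \<ge> 0"
  using W_lipschitz[of 0 1] by simp

lemma continuous_W: "continuous_on UNIV W"
  by (rule lipschitz_on_continuous_on[of L])
    (use W_lipschitz L_nonneg in \<open>auto simp: lipschitz_on_def dist_real_def\<close>)

lemma W_bounds: "c 1 \<le> W y" "W y \<le> c 0"
  using W_left[of y] W_right[of y] W_between[of y] c_order by (cases "y \<le> \<alpha>"; cases "\<beta> \<le> y"; force)+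

lemma drift0_zero_iff: "drift 0 y = 0 \<longleftrightarrow> y \<le> \<alpha>"
  using W_left[of y] W_right[of y] W_between[of y] c_order
  by (cases "y \<le> \<alpha>"; cases "\<beta> \<le> y") (auto simp: drift_def)

lemma drift0_nonneg: "drift 0 y \<ge> 0"
  using W_bounds by (simp add: drift_def)

lemma drift1_zero_iff: "drift 1 y = 0 \<longleftrightarrow> \<beta> \<le> y"
  using W_left[of y] W_right[of y] W_between[of y] c_order
  by (cases "y \<le> \<alpha>"; cases "\<beta> \<le> y") (auto simp: drift_def)

lemma drift1_nonpos: "drift 1 y \<le> 0"
  using W_bounds by (simp add: drift_def)

lemma drift0_pos: "\<alpha> < y \<Longrightarrow> drift 0 y > 0"
  using drift0_zero_iff[of y] drift0_nonneg[of y] by linarith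

lemma drift1_neg: "y < \<beta> \<Longrightarrow> drift 1 y < 0"
  using drift1_zero_iff[of y] drift1_nonpos[of y] by linarith

lemma isCont_drift: "isCont (drift i) y"
  using continuous_W unfolding drift_def
  by (intro continuous_intros) (simp add: continuous_on_eq_continuous_at)

text \<open>
  The functions \<open>exp (l i * \<Phi> i)\<close>, continued to the whole line; they vanish where the drift in state \<open>i\<close>
  vanishes.
\<close>
definition exp_solutions :: "(nat \<Rightarrow> real \<Rightarrow> real) \<Rightarrow> bool" where
  "exp_solutions E \<longleftrightarrow> (\<forall>i\<in>{0, 1}. continuous_on UNIV (E i) \<and>
     (\<forall>y. (drift i y = 0 \<longrightarrow> E i y = 0) \<and> (drift i y \<noteq> 0 \<longrightarrow> E i y > 0 \<and>
       (E i has_real_derivative l i * E i y / drift i y) (at y))))"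

text \<open>
  For state 1 the reflection \<open>y \<mapsto> - y\<close> turns the negative drift into a positive one.
\<close>
lemma ex_exp_solutions:
  assumes \<Phi>: "\<And>i y. i \<in> {0, 1} \<Longrightarrow> y \<in> {\<alpha><..<\<beta>} \<Longrightarrow>
               (\<Phi> i has_real_derivative 1 / drift i y) (at y)"
  obtains E where "exp_solutions E"
    "\<And>i y. i \<in> {0, 1} \<Longrightarrow> y \<in> {\<alpha><..<\<beta>} \<Longrightarrow> E i y = exp (l i * \<Phi> i y)"
proof -
  obtain E0 where E0: "continuous_on UNIV E0" "\<And>y. y \<le> \<alpha> \<Longrightarrow> E0 y = 0" "\<And>y. y > \<alpha> \<Longrightarrow> E0 y > 0"
    "\<And>y. y > \<alpha> \<Longrightarrow> (E0 has_real_derivative l 0 * E0 y / drift 0 y) (at y)"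
    "\<And>y. y \<in> {\<alpha><..<\<beta>} \<Longrightarrow> E0 y = exp (l 0 * \<Phi> 0 y)"
  proof (rule exp_antiderivative_extension[of "drift 0" L \<alpha> "l 0" \<beta> "\<Phi> 0"])
    show "drift 0 \<alpha> = 0" by (simp add: drift0_zero_iff)
  qed (use drift_lipschitz drift0_pos rates ends \<Phi> in auto)
  have neg: "\<And>y. - drift 1 (- y) > 0 \<longleftrightarrow> - \<beta> < y"
    using drift1_zero_iff drift1_nonpos drift1_neg by (smt (verit))
  obtain E1 where E1: "continuous_on UNIV E1" "\<And>y. y \<le> - \<beta> \<Longrightarrow> E1 y = 0" "\<And>y. y > - \<beta> \<Longrightarrow> E1 y > 0"
    "\<And>y. y > - \<beta> \<Longrightarrow> (E1 has_real_derivative l 1 * E1 y / (- drift 1 (- y))) (at y)"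
    "\<And>y. y \<in> {- \<beta><..<- \<alpha>} \<Longrightarrow> E1 y = exp (l 1 * \<Phi> 1 (- y))"
  proof (rule exp_antiderivative_extension[of "\<lambda>y. - drift 1 (- y)" L "- \<beta>" "l 1" "- \<alpha>" "\<lambda>y. \<Phi> 1 (- y)"])
    show "\<bar>- drift 1 (- y) - - drift 1 (- z)\<bar> \<le> L * \<bar>y - z\<bar>" for y z
      using drift_lipschitz[of 1 "- z" "- y"] by simp
    show "- drift 1 (- (- \<beta>)) = 0" by (simp add: drift1_zero_iff[simplified])
    show "((\<lambda>y. \<Phi> 1 (- y)) has_real_derivative 1 / (- drift 1 (- y))) (at y)"
      if "y \<in> {- \<beta><..<- \<alpha>}" for y
      using \<Phi>[of 1 "- y"] that DERIV_mirror[of "\<Phi> 1" "1 / drift 1 (- y)" y] by simp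
  qed (use neg rates ends in auto)
  define E where "E i = (if i = 0 then E0 else (\<lambda>y. E1 (- y)))" for i :: nat
  have d1: "((\<lambda>y. E1 (- y)) has_real_derivative l 1 * E1 (- y) / drift 1 y) (at y)" if "y < \<beta>" for y
    using E1(4)[of "- y"] that DERIV_mirror[of E1 "l 1 * E1 (- y) / (- drift 1 y)" y] by simp
  have "exp_solutions E"
    unfolding exp_solutions_def
  proof (intro ballI conjI allI impI)
    fix i :: nat and y assume i: "i \<in> {0, 1}"
    show "continuous_on UNIV (E i)"
      using E0(1) continuous_on_compose2[OF E1(1), of UNIV uminus]
      by (auto simp: E_def continuous_on_minus continuous_on_id)
    show "E i y = 0" if "drift i y = 0"
      using i that drift0_zero_iff[of y] drift1_zero_iff[of y] E0(2) E1(2) by (auto simp: E_def)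
    show "E i y > 0" if "drift i y \<noteq> 0"
      using i that drift0_zero_iff[of y] drift1_zero_iff[of y] E0(3) E1(3) by (auto simp: E_def)
    show "(E i has_real_derivative l i * E i y / drift i y) (at y)" if "drift i y \<noteq> 0"
      using i that drift0_zero_iff[of y] drift1_zero_iff[of y] E0(4) d1 by (auto simp: E_def)
  qed
  moreover have "E i y = exp (l i * \<Phi> i y)" if "i \<in> {0, 1}" "y \<in> {\<alpha><..<\<beta>}" for i y
    using that E0(5) E1(5)[of "- y"] by (auto simp: E_def)
  ultimately show ?thesis using that by blast
qed

text \<open>
  The integrand \<open>f 0\<close> is continuous beyond \<open>\<beta>\<close> (where it is 0) but may be unbounded at \<open>\<alpha>\<close>, and
  conversely for \<open>f 1\<close>.  Each integral is therefore controlled at its bad end by the other one through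
  \<open>F' = l 0 * f 0 + l 1 * f 1\<close>; the same relation gives the backward equations and the continuity of
  the solution at both ends.
\<close>
lemma ex_exit_function:
  assumes E: "exp_solutions E"
  defines "f \<equiv> \<lambda>i y. E 0 y * E 1 y / drift i y"
  assumes x: "x \<in> {\<alpha><..<\<beta>}"
  obtains u where "\<And>i. i \<in> {0, 1} \<Longrightarrow> continuous_on UNIV (u i)"
    "\<And>i y. i \<in> {0, 1} \<Longrightarrow> y \<le> \<alpha> \<Longrightarrow> u i y = 0"
    "\<And>i y. i \<in> {0, 1} \<Longrightarrow> y \<ge> \<beta> \<Longrightarrow> u i y = 1"
    "\<And>i y. i \<in> {0, 1} \<Longrightarrow> drift i y \<noteq> 0 \<Longrightarrow>
       (u i has_real_derivative l i * (u i y - u (1 - i) y) / drift i y) (at y)"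
    "u 0 x = 1 - inverse (LBINT y=\<alpha>..\<beta>. f 0 y) * (LBINT y=x..\<beta>. f 0 y)"
    "u 1 x = inverse (LBINT y=\<alpha>..\<beta>. f 1 y) * (LBINT y=\<alpha>..x. f 1 y)"
proof -
  define F where "F y = E 0 y * E 1 y" for y
  have contE: "isCont (E i) y" if "i \<in> {0, 1}" for i y
    using E that by (auto simp: exp_solutions_def continuous_on_eq_continuous_at)
  have contF: "isCont F y" for y
    unfolding F_def by (intro continuous_intros contE) auto
  have F0: "F y = 0" if "y \<le> \<alpha> \<or> y \<ge> \<beta>" for y
    using that E by (auto simp: F_def exp_solutions_def drift0_zero_iff drift1_zero_iff[simplified])
  have Fpos: "F y > 0" if "\<alpha> < y" "y < \<beta>" for y
    using that E by (auto simp: F_def exp_solutions_def drift0_zero_iff drift1_zero_iff[simplified])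
  have f_def': "f i y = F y / drift i y" for i y
    by (simp add: f_def F_def)
  have contf: "isCont (f i) y" if "drift i y \<noteq> 0" for i y
    using that unfolding f_def' by (intro continuous_intros contF isCont_drift)
  have "\<exists>H. \<forall>y::real. ereal \<alpha> < y \<longrightarrow> y < \<infinity> \<longrightarrow> (H has_vector_derivative f 0 y) (at y)"
    by (rule einterval_antiderivative) (auto intro!: contf simp: drift0_zero_iff)
  then obtain H0 where H0: "\<And>y. y > \<alpha> \<Longrightarrow> (H0 has_real_derivative f 0 y) (at y)"
    by (auto simp: has_real_derivative_iff_has_vector_derivative)
  have "\<exists>H. \<forall>y::real. -\<infinity> < ereal y \<longrightarrow> y < ereal \<beta> \<longrightarrow> (H has_vector_derivative f 1 y) (at y)"
    by (rule einterval_antiderivative) (auto intro!: contf simp: drift1_zero_iff[simplified])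
  then obtain H1 where H1: "\<And>y. y < \<beta> \<Longrightarrow> (H1 has_real_derivative f 1 y) (at y)"
    by (auto simp: has_real_derivative_iff_has_vector_derivative)
  have dF: "(F has_real_derivative l 0 * f 0 y + l 1 * f 1 y) (at y)" if "y \<in> {\<alpha><..<\<beta>}" for y
  proof -
    have "(F has_real_derivative E 0 y * (l 1 * E 1 y / drift 1 y) + l 0 * E 0 y / drift 0 y * E 1 y) (at y)"
      unfolding F_def using that E
      by (intro DERIV_mult') (auto simp: exp_solutions_def drift0_zero_iff drift1_zero_iff[simplified])
    then show ?thesis by (simp add: f_def algebra_simps)
  qed
  have "(\<lambda>y. l 0 * H0 y + l 1 * H1 y - F y) constant_on {\<alpha><..<\<beta>}"
  proof (rule has_field_derivative_0_imp_constant_on)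
    show "((\<lambda>y. l 0 * H0 y + l 1 * H1 y - F y) has_field_derivative 0) (at z)" if "z \<in> {\<alpha><..<\<beta>}" for z
      using that by (auto intro!: derivative_eq_intros H0 H1 dF)
  qed auto
  then obtain k where k: "\<And>y. y \<in> {\<alpha><..<\<beta>} \<Longrightarrow> l 0 * H0 y + l 1 * H1 y - F y = k"
    by (auto simp: constant_on_def)
  \<comment> \<open>the limits of \<open>H0\<close> at \<open>\<alpha>\<close> and of \<open>H1\<close> at \<open>\<beta>\<close>, read off from \<open>F \<alpha> = F \<beta> = 0\<close>\<close>
  define h0 where "h0 = (k - l 1 * H1 \<alpha>) / l 0"
  define h1 where "h1 = (k - l 0 * H0 \<beta>) / l 1"
  have H0_right: "H0 y = H0 \<beta>" if "y \<ge> \<beta>" for y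
  proof -
    have "\<exists>c. \<forall>y\<in>{\<beta>..}. H0 y = c"
    proof (rule has_field_derivative_zero_constant)
      fix z assume "z \<in> {\<beta>..}"
      then show "(H0 has_field_derivative 0) (at z within {\<beta>..})"
        using H0[of z] F0[of z] ends by (auto simp: f_def' intro: has_field_derivative_at_within)
    qed auto
    then show ?thesis using that by auto
  qed
  have H1_left: "H1 y = H1 \<alpha>" if "y \<le> \<alpha>" for y
  proof -
    have "\<exists>c. \<forall>y\<in>{..\<alpha>}. H1 y = c"
    proof (rule has_field_derivative_zero_constant)
      fix z assume "z \<in> {..\<alpha>}"
      then show "(H1 has_field_derivative 0) (at z within {..\<alpha>})"
        using H1[of z] F0[of z] ends by (auto simp: f_def' intro: has_field_derivative_at_within)
    qed auto
    then show ?thesis using that by auto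
  qed
  have contH1: "isCont H1 \<alpha>" and contH0: "isCont H0 \<beta>"
    using H1[of \<alpha>] H0[of \<beta>] ends DERIV_isCont by auto
  have inside_right: "\<forall>\<^sub>F y in at_right \<alpha>. y \<in> {\<alpha><..<\<beta>}"
    using ends by (auto simp: eventually_at_right_field intro!: exI[of _ \<beta>])
  have inside_left: "\<forall>\<^sub>F y in at_left \<beta>. y \<in> {\<alpha><..<\<beta>}"
    using ends by (auto simp: eventually_at_left_field intro!: exI[of _ \<alpha>])
  have lim0: "(H0 \<longlongrightarrow> h0) (at_right \<alpha>)"
  proof (rule Lim_transform_eventually)
    have "(F \<longlongrightarrow> 0) (at_right \<alpha>)" "(H1 \<longlongrightarrow> H1 \<alpha>) (at_right \<alpha>)"
      using contF[of \<alpha>] contH1 F0[of \<alpha>] by (auto simp: isCont_def intro: filterlim_mono at_le tendsto_within_subset)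
    then have "((\<lambda>y. (k + F y - l 1 * H1 y) / l 0) \<longlongrightarrow> (k + 0 - l 1 * H1 \<alpha>) / l 0) (at_right \<alpha>)"
      by (intro tendsto_intros) (use rates in auto)
    then show "((\<lambda>y. (k + F y - l 1 * H1 y) / l 0) \<longlongrightarrow> h0) (at_right \<alpha>)"
      by (simp add: h0_def)
    show "\<forall>\<^sub>F y in at_right \<alpha>. (k + F y - l 1 * H1 y) / l 0 = H0 y"
      using inside_right
    proof eventually_elim
      case (elim y)
      then show ?case using k[of y] rates by (simp add: field_simps)
    qed
  qed
  have lim1: "(H1 \<longlongrightarrow> h1) (at_left \<beta>)"
  proof (rule Lim_transform_eventually)
    have "(F \<longlongrightarrow> 0) (at_left \<beta>)" "(H0 \<longlongrightarrow> H0 \<beta>) (at_left \<beta>)"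
      using contF[of \<beta>] contH0 F0[of \<beta>] by (auto simp: isCont_def intro: tendsto_within_subset)
    then have "((\<lambda>y. (k + F y - l 0 * H0 y) / l 1) \<longlongrightarrow> (k + 0 - l 0 * H0 \<beta>) / l 1) (at_left \<beta>)"
      by (intro tendsto_intros) (use rates in auto)
    then show "((\<lambda>y. (k + F y - l 0 * H0 y) / l 1) \<longlongrightarrow> h1) (at_left \<beta>)"
      by (simp add: h1_def)
    show "\<forall>\<^sub>F y in at_left \<beta>. (k + F y - l 0 * H0 y) / l 1 = H1 y"
      using inside_left
    proof eventually_elim
      case (elim y)
      then show ?case using k[of y] rates by (simp add: field_simps)
    qed
  qed
  have int0: "(LBINT y=p..\<beta>. f 0 y) = H0 \<beta> - A"
    if "\<alpha> \<le> p" "p < \<beta>" "(H0 \<longlongrightarrow> A) (at_right p)" for p A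
  proof (rule interval_integral_FTC_nonneg(2))
    show "((H0 \<circ> real_of_ereal) \<longlongrightarrow> A) (at_right (ereal p))"
      unfolding ereal_tendsto_simps by (rule that)
    show "((H0 \<circ> real_of_ereal) \<longlongrightarrow> H0 \<beta>) (at_left (ereal \<beta>))"
      unfolding ereal_tendsto_simps
      using contH0 by (auto simp: isCont_def intro: tendsto_within_subset)
    show "AE y in lborel. ereal p < ereal y \<longrightarrow> ereal y < ereal \<beta> \<longrightarrow> 0 \<le> f 0 y"
      using that(1) Fpos drift0_nonneg by (auto simp: f_def' less_imp_le)
  qed (use that H0 contf in \<open>auto simp: drift0_zero_iff\<close>)
  have int1: "(LBINT y=\<alpha>..p. f 1 y) = A - H1 \<alpha>"
    if "\<alpha> < p" "p \<le> \<beta>" "(H1 \<longlongrightarrow> A) (at_left p)" for p A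
  proof -
    have "(LBINT y=\<alpha>..p. - f 1 y) = (- A) - (- H1 \<alpha>)"
    proof (rule interval_integral_FTC_nonneg(2)[where F = "\<lambda>y. - H1 y"])
      show "(((\<lambda>y. - H1 y) \<circ> real_of_ereal) \<longlongrightarrow> - A) (at_left (ereal p))"
        unfolding ereal_tendsto_simps using that(3) by (intro tendsto_intros)
      show "(((\<lambda>y. - H1 y) \<circ> real_of_ereal) \<longlongrightarrow> - H1 \<alpha>) (at_right (ereal \<alpha>))"
        unfolding ereal_tendsto_simps
        using contH1 by (intro tendsto_intros) (auto simp: isCont_def intro: tendsto_within_subset)
      show "AE y in lborel. ereal \<alpha> < ereal y \<longrightarrow> ereal y < ereal p \<longrightarrow> 0 \<le> - f 1 y"
        using that(2) Fpos drift1_nonpos by (auto simp: f_def' less_imp_le divide_nonneg_nonpos)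
      show "isCont (\<lambda>y. - f 1 y) y" if "ereal \<alpha> < ereal y" "ereal y < ereal p" for y
        using that \<open>p \<le> \<beta>\<close> contf[of 1 y] drift1_zero_iff[of y] by (intro continuous_minus) auto
      show "((\<lambda>y. - H1 y) has_real_derivative - f 1 y) (at y)" if "ereal \<alpha> < ereal y" "ereal y < ereal p" for y
        using that \<open>p \<le> \<beta>\<close> by (intro DERIV_minus H1) auto
    qed (use that in auto)
    then show ?thesis by (simp add: interval_lebesgue_integral_uminus)
  qed
  define B0 where "B0 = H0 \<beta> - h0"
  define B1 where "B1 = h1 - H1 \<alpha>"
  have B_eq: "(LBINT y=\<alpha>..\<beta>. f 0 y) = B0" "(LBINT y=\<alpha>..\<beta>. f 1 y) = B1"
    using int0[of \<alpha>] int1[of \<beta>] lim0 lim1 ends by (auto simp: B0_def B1_def)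
  have rel: "l 0 * B0 = - l 1 * B1"
    using rates by (simp add: B0_def B1_def h0_def h1_def field_simps)
  have B0: "B0 > 0"
  proof -
    let ?m = "(\<alpha> + \<beta>) / 2"
    have "h0 \<le> H0 ?m"
    proof (rule tendsto_upperbound[OF lim0])
      have "\<forall>\<^sub>F y in at_right \<alpha>. y < ?m"
        using ends by (auto simp: eventually_at_right_field intro!: exI[of _ ?m])
      with inside_right show "\<forall>\<^sub>F y in at_right \<alpha>. H0 y \<le> H0 ?m"
      proof eventually_elim
        case (elim y)
        have "\<exists>D. (H0 has_real_derivative D) (at z) \<and> D \<ge> 0" if "y \<le> z" "z \<le> ?m" for z
          using H0[of z] Fpos[of z] that elim ends drift0_nonneg[of z] by (auto simp: f_def' less_imp_le)
        then show ?case using elim by (intro DERIV_nonneg_imp_nondecreasing[of y ?m H0]) auto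
      qed
    qed auto
    also have "H0 ?m < H0 \<beta>"
    proof (rule DERIV_pos_imp_increasing_open[of ?m \<beta> H0])
      show "\<exists>D. (H0 has_real_derivative D) (at z) \<and> D > 0" if "?m < z" "z < \<beta>" for z
        using H0[of z] Fpos[of z] that ends drift0_pos[of z] by (auto simp: f_def')
      show "continuous_on {?m..\<beta>} H0"
        using H0 ends by (intro DERIV_continuous_on[of _ _ "f 0"]) (auto intro: has_field_derivative_at_within)
    qed (use ends in auto)
    finally show ?thesis by (simp add: B0_def)
  qed
  have B1: "B1 \<noteq> 0" using rel B0 rates by auto
  define u0 where "u0 y = (if y \<le> \<alpha> then 0 else (H0 y - h0) / B0)" for y
  define u1 where "u1 y = (if y \<ge> \<beta> then 1 else (H1 y - H1 \<alpha>) / B1)" for y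
  have u_left: "u0 y = 0" "u1 y = 0" if "y \<le> \<alpha>" for y
    using that ends H1_left[OF that] by (auto simp: u0_def u1_def)
  have u_right: "u0 y = 1" "u1 y = 1" if "y \<ge> \<beta>" for y
    using that ends H0_right[OF that] B0 by (auto simp: u0_def u1_def B0_def)
  have diff: "l 0 * B0 * (u0 y - u1 y) = F y" for y
  proof (cases "\<alpha> < y \<and> y < \<beta>")
    case True
    have "l 0 * B0 * (u0 y - u1 y) = l 0 * (B0 * u0 y) + l 1 * (B1 * u1 y)"
    proof -
      have "l 0 * B0 * u1 y = - l 1 * B1 * u1 y" by (simp only: rel)
      then show ?thesis by (simp add: algebra_simps)
    qed
    also have "\<dots> = l 0 * (H0 y - h0) + l 1 * (H1 y - H1 \<alpha>)"
      using True B0 B1 by (simp add: u0_def u1_def)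
    also have "\<dots> = F y"
    proof -
      have "l 0 * h0 = k - l 1 * H1 \<alpha>" using rates by (simp add: h0_def)
      then show ?thesis using k[of y] True by (simp add: algebra_simps)
    qed
    finally show ?thesis .
  next
    case False
    then show ?thesis using F0[of y] u_left[of y] u_right[of y] by auto
  qed
  have du0: "(u0 has_real_derivative l 0 * (u0 y - u1 y) / drift 0 y) (at y)" if "y > \<alpha>" for y
  proof -
    have "((\<lambda>y. (H0 y - h0) / B0) has_real_derivative f 0 y / B0) (at y)"
      using H0[OF that] B0 by (auto intro!: derivative_eq_intros)
    moreover have "f 0 y / B0 = l 0 * (u0 y - u1 y) / drift 0 y"
      unfolding f_def' diff[of y, symmetric] using B0 by simp
    ultimately have "((\<lambda>y. (H0 y - h0) / B0) has_real_derivative l 0 * (u0 y - u1 y) / drift 0 y) (at y)"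
      by simp
    then show ?thesis
    proof (rule has_field_derivative_transform_within_open[of _ _ _ "{\<alpha><..}"])
      show "\<And>x. x \<in> {\<alpha><..} \<Longrightarrow> (H0 x - h0) / B0 = u0 x" by (simp add: u0_def)
    qed (use that in auto)
  qed
  have du1: "(u1 has_real_derivative l 1 * (u1 y - u0 y) / drift 1 y) (at y)" if "y < \<beta>" for y
  proof -
    have "((\<lambda>y. (H1 y - H1 \<alpha>) / B1) has_real_derivative f 1 y / B1) (at y)"
      using H1[OF that] B1 by (auto intro!: derivative_eq_intros)
    moreover have "f 1 y / B1 = l 1 * (u1 y - u0 y) / drift 1 y"
    proof -
      have "F y = (- l 1 * B1) * (u0 y - u1 y)" using diff[of y] unfolding rel by simp
      then have "F y / B1 = l 1 * (u1 y - u0 y)" using B1 by (simp add: divide_simps algebra_simps)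
      moreover have "f 1 y / B1 = F y / B1 / drift 1 y" by (simp add: f_def' mult.commute)
      ultimately show ?thesis by simp
    qed
    ultimately have "((\<lambda>y. (H1 y - H1 \<alpha>) / B1) has_real_derivative l 1 * (u1 y - u0 y) / drift 1 y) (at y)"
      by simp
    then show ?thesis
    proof (rule has_field_derivative_transform_within_open[of _ _ _ "{..<\<beta>}"])
      show "\<And>x. x \<in> {..<\<beta>} \<Longrightarrow> (H1 x - H1 \<alpha>) / B1 = u1 x" by (simp add: u1_def)
    qed (use that in auto)
  qed
  \<comment> \<open>\<open>u0\<close> is differentiable except at \<open>\<alpha>\<close>, \<open>u1\<close> except at \<open>\<beta>\<close>, and their difference is continuous\<close>
  have u0_eq: "u0 = (\<lambda>y. u1 y + F y / (l 0 * B0))" and u1_eq: "u1 = (\<lambda>y. u0 y - F y / (l 0 * B0))"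
    using diff B0 rates by (auto simp: fun_eq_iff field_simps)
  have cont0: "isCont u0 y" for y
  proof (cases "y > \<alpha>")
    case True then show ?thesis using du0 DERIV_isCont by blast
  next
    case False
    then have "isCont u1 y" using du1[of y] ends DERIV_isCont by auto
    then show ?thesis unfolding u0_eq using contF rates B0 by (intro continuous_intros) auto
  qed
  have cont1: "isCont u1 y" for y
    unfolding u1_eq using cont0 contF rates B0 by (intro continuous_intros) auto
  define u where "u i = (if i = 0 then u0 else u1)" for i :: nat
  show ?thesis
  proof (rule that[of u])
    show "continuous_on UNIV (u i)" for i
      using cont0 cont1 by (simp add: u_def continuous_at_imp_continuous_on)
    show "u i y = 0" if "y \<le> \<alpha>" for i y
      using that u_left by (simp add: u_def)
    show "u i y = 1" if "y \<ge> \<beta>" for i y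
      using that u_right by (simp add: u_def)
    show "(u i has_real_derivative l i * (u i y - u (1 - i) y) / drift i y) (at y)"
      if "i \<in> {0, 1}" "drift i y \<noteq> 0" for i y
      using that du0[of y] du1[of y] drift0_zero_iff[of y] drift1_zero_iff[of y] by (auto simp: u_def)
    have "isCont H0 x" "isCont H1 x"
      using x H0[of x] H1[of x] DERIV_isCont by auto
    then have "(H0 \<longlongrightarrow> H0 x) (at_right x)" "(H1 \<longlongrightarrow> H1 x) (at_left x)"
      by (auto simp: isCont_def intro: tendsto_within_subset)
    then have "(LBINT y=x..\<beta>. f 0 y) = H0 \<beta> - H0 x" "(LBINT y=\<alpha>..x. f 1 y) = H1 x - H1 \<alpha>"
      using int0[of x] int1[of x] x by auto
    then show "u 0 x = 1 - inverse (LBINT y=\<alpha>..\<beta>. f 0 y) * (LBINT y=x..\<beta>. f 0 y)"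
      "u 1 x = inverse (LBINT y=\<alpha>..\<beta>. f 1 y) * (LBINT y=\<alpha>..x. f 1 y)"
      unfolding B_eq using x B0 B1 by (auto simp: u_def u0_def u1_def B0_def field_simps)
  qed
qed

end

section \<open>Pathwise convergence of the Euler scheme\<close>

text \<open>
  An accumulation point of switching times would contradict the one-sided constancy of the path there.
\<close>
lemma finite_switches:
  fixes \<sigma> :: "real \<Rightarrow> 'a"
  assumes right: "\<And>t. t \<ge> 0 \<Longrightarrow> \<forall>\<^sub>F s in at_right t. \<sigma> s = \<sigma> t"
    and left: "\<And>t. t > 0 \<Longrightarrow> \<exists>j. \<forall>\<^sub>F s in at_left t. \<sigma> s = j"
  shows "finite {t\<in>{0<..<T}. \<not> (\<forall>\<^sub>F s in at t. \<sigma> s = \<sigma> t)}" (is "finite ?S")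
proof (rule ccontr)
  assume "infinite ?S"
  then obtain z where z: "z \<in> {0..T}" "z islimpt ?S"
    using Heine_Borel_imp_Bolzano_Weierstrass[of "{0..T}" ?S] by fastforce
  have locally_constant: "s \<notin> ?S" if "s \<in> {a<..<b}" "\<And>r. r \<in> {a<..<b} \<Longrightarrow> \<sigma> r = j" for a b s j
  proof -
    have "\<forall>\<^sub>F r in at s. r \<in> {a<..<b}"
      using that(1) by (intro eventually_at_in_open') auto
    then have "\<forall>\<^sub>F r in at s. \<sigma> r = \<sigma> s"
      using that by (auto elim!: eventually_mono)
    then show ?thesis by simp
  qed
  obtain b where b: "b > z" "\<And>r. r \<in> {z<..<b} \<Longrightarrow> \<sigma> r = \<sigma> z"
    using right[of z] z(1) by (auto simp: eventually_at_right_field)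
  obtain a where a: "a < z" "\<And>s. s \<in> {a<..<z} \<Longrightarrow> s \<notin> ?S"
  proof (cases "z = 0")
    case True
    then show ?thesis using that[of "-1"] by auto
  next
    case False
    then obtain j where "\<forall>\<^sub>F s in at_left z. \<sigma> s = j" using left[of z] z(1) by auto
    then obtain a where "a < z" "\<And>r. r \<in> {a<..<z} \<Longrightarrow> \<sigma> r = j"
      by (auto simp: eventually_at_left_field)
    then show ?thesis using that[of a] locally_constant by blast
  qed
  define e where "e = min (b - z) (z - a)"
  have "e > 0" using a b by (simp add: e_def)
  then obtain s where s: "s \<in> ?S" "s \<noteq> z" "dist s z < e"
    using z(2) unfolding islimpt_approachable by blast
  then have "s \<in> {z<..<b} \<or> s \<in> {a<..<z}"
    by (auto simp: e_def dist_real_def)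
  then show False
    using s(1) a(2) locally_constant b(2) by blast
qed

lemma constant_between_switches:
  fixes \<sigma> :: "real \<Rightarrow> 'a"
  assumes right: "\<And>t. t \<ge> 0 \<Longrightarrow> \<forall>\<^sub>F s in at_right t. \<sigma> s = \<sigma> t"
    and "0 \<le> a" and cont: "\<And>t. t \<in> {a<..<b} \<Longrightarrow> \<forall>\<^sub>F s in at t. \<sigma> s = \<sigma> t"
    and s: "s \<in> {a..<b}"
  shows "\<sigma> s = \<sigma> a"
proof (rule connected_local_const[of "{a..<b}"])
  show "\<forall>t\<in>{a..<b}. \<forall>\<^sub>F r in at t within {a..<b}. \<sigma> t = \<sigma> r"
  proof
    fix t assume t: "t \<in> {a..<b}"
    show "\<forall>\<^sub>F r in at t within {a..<b}. \<sigma> t = \<sigma> r"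
    proof (cases "t = a")
      case True
      have "\<forall>\<^sub>F r in at a within {a..<b}. \<sigma> r = \<sigma> a"
        using right[OF \<open>0 \<le> a\<close>] unfolding eventually_at_filter
        by (auto elim!: eventually_mono)
      then show ?thesis unfolding True by (auto elim!: eventually_mono)
    next
      case False
      then have "\<forall>\<^sub>F r in at t. \<sigma> r = \<sigma> t" using cont t by auto
      then have "\<forall>\<^sub>F r in at t within {a..<b}. \<sigma> r = \<sigma> t"
        unfolding eventually_at_filter by (auto elim!: eventually_mono)
      then show ?thesis by (auto elim!: eventually_mono)
    qed
  qed
qed (use s in auto)

lemma has_integral_increment:
  fixes f :: "real \<Rightarrow> real"
  assumes "\<And>t. 0 \<le> t \<Longrightarrow> t \<le> b \<Longrightarrow> (f has_integral (Z t - x)) {0..t}" "0 \<le> a" "a \<le> b"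
  shows "(f has_integral (Z b - Z a)) {a..b}"
proof -
  have int: "f integrable_on {0..b}" using assms(1)[of b] assms(2,3) by auto
  have "integral {0..a} f + integral {a..b} f = integral {0..b} f"
    using assms int by (intro Henstock_Kurzweil_Integration.integral_combine) auto
  then have "integral {a..b} f = Z b - Z a"
    using assms(1)[of a, THEN integral_unique] assms(1)[of b, THEN integral_unique] assms(2,3) by auto
  moreover have "f integrable_on {a..b}"
    using int by (rule integrable_subinterval_real) (use assms in auto)
  ultimately show ?thesis by (simp add: has_integral_iff)
qed

context opposing_drifts
begin

lemma abs_drift_le: "i \<in> {0, 1} \<Longrightarrow> \<bar>drift i y\<bar> \<le> c 0 - c 1"
  using W_bounds[of y] by (auto simp: drift_def)

primrec euler :: "real \<Rightarrow> (nat \<Rightarrow> nat) \<Rightarrow> real \<Rightarrow> nat \<Rightarrow> real" where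
  "euler h s x 0 = x"
| "euler h s x (Suc k) = euler h s x k + h * drift (s k) (euler h s x k)"

text \<open>
  A discrete Gronwall estimate.  The local error is of order \<open>h\<^sup>2\<close> on a step without a switch inside
  and of order \<open>h\<close> on the others, whose number is bounded independently of \<open>h\<close>.
\<close>
lemma euler_converges:
  assumes right: "\<And>t. t \<ge> 0 \<Longrightarrow> \<forall>\<^sub>F s in at_right t. \<sigma> s = \<sigma> t"
    and left: "\<And>t. t > 0 \<Longrightarrow> \<exists>j. \<forall>\<^sub>F s in at_left t. \<sigma> s = j"
    and states: "\<And>t. t \<ge> 0 \<Longrightarrow> \<sigma> t \<in> {0, 1}"
    and Z: "\<And>t. t \<ge> 0 \<Longrightarrow> ((\<lambda>s. drift (\<sigma> s) (Z s)) has_integral (Z t - x)) {0..t}"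
    and "T > 0"
  shows "(\<lambda>n. euler (T / real n) (\<lambda>k. \<sigma> (real k * (T / real n))) x n) \<longlonglongrightarrow> Z T"
proof -
  define S where "S = {t\<in>{0<..<T}. \<not> (\<forall>\<^sub>F s in at t. \<sigma> s = \<sigma> t)}"
  have S: "finite S" unfolding S_def using right left by (rule finite_switches)
  define D where "D = c 0 - c 1"
  have D: "D > 0" using c_order by (simp add: D_def)
  have Z0: "Z 0 = x"
    using has_integral_unique[OF Z[of 0], of 0] by (simp add: has_integral_refl)
  have Z_lip: "\<bar>Z t - Z s\<bar> \<le> D * (t - s)" if "0 \<le> s" "s \<le> t" for s t
  proof -
    have "((\<lambda>r. drift (\<sigma> r) (Z r)) has_integral (Z t - Z s)) (cbox s t)"
      using has_integral_increment[of t _ Z x s] Z that by auto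
    then have "norm (Z t - Z s) \<le> D * measure lborel (cbox s t)"
      using D states that abs_drift_le by (intro has_integral_bound) (auto simp: D_def)
    then show ?thesis using that by simp
  qed
  have bound: "\<bar>euler (T / real n) (\<lambda>k. \<sigma> (real k * (T / real n))) x n - Z T\<bar>
      \<le> exp (L * T) * (T / real n) * (D * card S + L * D * T)" if n: "n > 0" for n
  proof -
    define h where "h = T / real n"
    have h: "h > 0" "real n * h = T" using n \<open>T > 0\<close> by (simp_all add: h_def)
    define Y where "Y = euler h (\<lambda>k. \<sigma> (real k * h)) x"
    define J where "J k = {real k * h<..<real (Suc k) * h}" for k
    \<comment> \<open>\<open>d k\<close> bounds the change of \<open>c (\<sigma> s)\<close> within step \<open>k\<close>; distinct steps with \<open>d k > 0\<close> contain distinct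
      switching times because the intervals \<open>J k\<close> are disjoint\<close>
    define d where "d k = (if S \<inter> J k = {} then 0 else D)" for k
    have d0: "d k \<ge> 0" for k using D by (simp add: d_def)
    have step: "\<bar>Y (Suc k) - Z (real (Suc k) * h)\<bar>
        \<le> (1 + h * L) * \<bar>Y k - Z (real k * h)\<bar> + h * (d k + L * D * h)" if "k < n" for k
    proof -
      let ?a = "real k * h" and ?b = "real (Suc k) * h"
      have ab: "0 \<le> ?a" "?a \<le> ?b" "?b - ?a = h" using h by (auto simp: algebra_simps)
      have "?b \<le> T" unfolding h(2)[symmetric] using that h(1) by (intro mult_right_mono) auto
      let ?v = "drift (\<sigma> ?a) (Z ?a)"
      have "((\<lambda>s. drift (\<sigma> s) (Z s) - ?v) has_integral (Z ?b - Z ?a - h * ?v)) (cbox ?a ?b)"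
      proof -
        have "((\<lambda>s. drift (\<sigma> s) (Z s)) has_integral (Z ?b - Z ?a)) {?a..?b}"
          using has_integral_increment[of ?b _ Z x ?a] Z ab by auto
        moreover have "((\<lambda>s. ?v) has_integral (h * ?v)) {?a..?b}"
          using has_integral_const_real[of ?v ?a ?b] ab by simp
        ultimately show ?thesis by (simp only: has_integral_diff cbox_interval)
      qed
      then have "norm (Z ?b - Z ?a - h * ?v) \<le> (d k + L * D * h) * measure lborel (cbox ?a ?b)"
      proof (rule has_integral_bound_spike_finite[of _ "{?b}", rotated 2])
        fix s assume s: "s \<in> cbox ?a ?b - {?b}"
        have "\<bar>drift (\<sigma> s) (Z s) - ?v\<bar> \<le> \<bar>c (\<sigma> s) - c (\<sigma> ?a)\<bar> + \<bar>W (Z s) - W (Z ?a)\<bar>"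
          by (simp add: drift_def)
        also have "\<bar>c (\<sigma> s) - c (\<sigma> ?a)\<bar> \<le> d k"
        proof (cases "S \<inter> J k = {}")
          case True
          have "\<sigma> s = \<sigma> ?a"
          proof (rule constant_between_switches[OF right ab(1)])
            show "\<forall>\<^sub>F r in at t. \<sigma> r = \<sigma> t" if "t \<in> {?a<..<?b}" for t
            proof -
              have "?a < t" "t < ?b" using that by simp_all
              then have "t \<in> J k" "t \<in> {0<..<T}"
                using le_less_trans[OF ab(1)] less_le_trans[OF _ \<open>?b \<le> T\<close>] by (simp_all add: J_def)
              then show ?thesis using True by (auto simp: S_def)
            qed
          qed (use s in auto)
          then show ?thesis using d0 by simp
        next
          case False
          have "s \<ge> ?a" using s by simp
          then have "\<sigma> s \<in> {0, 1}" "\<sigma> ?a \<in> {0, 1}"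
            using states[OF order_trans[OF ab(1)]] states[OF ab(1)] by blast+
          then show ?thesis using False c_order by (auto simp: d_def D_def)
        qed
        also have "\<bar>W (Z s) - W (Z ?a)\<bar> \<le> L * D * h"
        proof -
          have "\<bar>W (Z s) - W (Z ?a)\<bar> \<le> L * \<bar>Z s - Z ?a\<bar>" by (rule W_lipschitz)
          also have "\<dots> \<le> L * (D * (s - ?a))"
            using Z_lip[of ?a s] s ab L_nonneg by (intro mult_left_mono) auto
          also have "\<dots> \<le> L * (D * h)"
            using s ab D L_nonneg by (intro mult_left_mono) auto
          finally show ?thesis by simp
        qed
        finally show "norm (drift (\<sigma> s) (Z s) - ?v) \<le> d k + L * D * h" by simp
      qed (use d0 D h L_nonneg in auto)
      then have err: "\<bar>Z ?b - Z ?a - h * ?v\<bar> \<le> h * (d k + L * D * h)"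
        using ab by (simp add: mult.commute)
      have "\<bar>drift (\<sigma> ?a) (Y k) - ?v\<bar> \<le> L * \<bar>Y k - Z ?a\<bar>" by (rule drift_lipschitz)
      then have "\<bar>h * (drift (\<sigma> ?a) (Y k) - ?v)\<bar> \<le> h * (L * \<bar>Y k - Z ?a\<bar>)"
        unfolding abs_mult using h by (intro mult_mono) auto
      moreover have "Y (Suc k) - Z ?b = (Y k - Z ?a) + h * (drift (\<sigma> ?a) (Y k) - ?v) - (Z ?b - Z ?a - h * ?v)"
        by (simp add: Y_def algebra_simps)
      then have "\<bar>Y (Suc k) - Z ?b\<bar> \<le> \<bar>Y k - Z ?a\<bar> + \<bar>h * (drift (\<sigma> ?a) (Y k) - ?v)\<bar> + \<bar>Z ?b - Z ?a - h * ?v\<bar>"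
        by linarith
      moreover have "(1 + h * L) * \<bar>Y k - Z ?a\<bar> = \<bar>Y k - Z ?a\<bar> + h * (L * \<bar>Y k - Z ?a\<bar>)"
        by (simp add: algebra_simps)
      ultimately show ?thesis
        using err by linarith
    qed
    have "m \<le> n \<Longrightarrow> \<bar>Y m - Z (real m * h)\<bar> \<le> (1 + h * L) ^ m * (\<Sum>k<m. h * (d k + L * D * h))" for m
    proof (induction m)
      case 0
      then show ?case by (simp add: Y_def Z0)
    next
      case (Suc m)
      let ?s = "\<lambda>m. \<Sum>k<m. h * (d k + L * D * h)" and ?q = "1 + h * L"
      have q: "?q \<ge> 1" using h L_nonneg by simp
      have "\<bar>Y (Suc m) - Z (real (Suc m) * h)\<bar> \<le> ?q * \<bar>Y m - Z (real m * h)\<bar> + h * (d m + L * D * h)"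
        using Suc by (intro step) auto
      also have "\<dots> \<le> ?q * (?q ^ m * ?s m) + ?q ^ Suc m * (h * (d m + L * D * h))"
      proof (intro add_mono mult_left_mono)
        have "1 * (h * (d m + L * D * h)) \<le> ?q ^ Suc m * (h * (d m + L * D * h))"
          using q h D L_nonneg d0[of m] by (intro mult_right_mono one_le_power) auto
        then show "h * (d m + L * D * h) \<le> ?q ^ Suc m * (h * (d m + L * D * h))" by simp
      qed (use Suc q in auto)
      also have "\<dots> = ?q ^ Suc m * ?s (Suc m)" by (simp add: algebra_simps)
      finally show ?case .
    qed
    then have "\<bar>Y n - Z T\<bar> \<le> (1 + h * L) ^ n * (\<Sum>k<n. h * (d k + L * D * h))"
      using h(2) by fastforce
    also have "\<dots> \<le> exp (L * T) * (h * (D * card S + L * D * T))"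
    proof (intro mult_mono)
      have "(1 + h * L) ^ n \<le> exp (h * L) ^ n"
        using h L_nonneg by (intro power_mono exp_ge_add_one_self) auto
      also have "\<dots> = exp (L * T)" using h(2) by (simp flip: exp_of_nat_mult add: mult_ac)
      finally show "(1 + h * L) ^ n \<le> exp (L * T)" .
      have "(\<Sum>k<n. d k) \<le> D * card S"
      proof -
        let ?bad = "{k. k < n \<and> S \<inter> J k \<noteq> {}}"
        have "\<exists>g. \<forall>k\<in>?bad. g k \<in> S \<inter> J k"
          by (intro bchoice) auto
        then obtain g where g: "\<And>k. k \<in> ?bad \<Longrightarrow> g k \<in> S \<and> g k \<in> J k" by auto
        have "inj_on g ?bad"
        proof (rule inj_onI, rule ccontr)
          fix j k assume jk: "j \<in> ?bad" "k \<in> ?bad" "g j = g k" "j \<noteq> k"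
          have no: "J i \<inter> J i' = {}" if "i < i'" for i i'
          proof -
            have "real (Suc i) * h \<le> real i' * h" using that h by (intro mult_right_mono) auto
            then show ?thesis by (auto simp: J_def)
          qed
          have "g j \<in> J j \<inter> J k" using g[OF jk(1)] g[OF jk(2)] jk(3) by auto
          then show False using no[of j k] no[of k j] jk(4) by (cases "j < k") auto
        qed
        then have "card ?bad \<le> card S"
          using g S by (intro card_inj_on_le[of g]) auto
        have "(\<Sum>k<n. d k) = (\<Sum>k\<in>?bad. D)"
          by (rule sum.mono_neutral_cong_right) (auto simp: d_def)
        also have "\<dots> = D * card ?bad" by simp
        also have "\<dots> \<le> D * card S"
          using \<open>card ?bad \<le> card S\<close> D by (intro mult_left_mono) auto
        finally show ?thesis .
      qed
      then have "(\<Sum>k<n. d k) + L * D * (n * h) \<le> D * card S + L * D * T"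
        using h(2) by simp
      then have "h * ((\<Sum>k<n. d k) + L * D * (n * h)) \<le> h * (D * card S + L * D * T)"
        using h by (intro mult_left_mono) auto
      then show "(\<Sum>k<n. h * (d k + L * D * h)) \<le> h * (D * card S + L * D * T)"
        by (simp add: sum.distrib algebra_simps flip: sum_distrib_left)
      show "0 \<le> (\<Sum>k<n. h * (d k + L * D * h))"
        using h d0 D L_nonneg by (intro sum_nonneg) auto
    qed auto
    finally show ?thesis by (simp add: Y_def h_def mult.assoc)
  qed
  have "(\<lambda>n. exp (L * T) * (T / real n) * (D * card S + L * D * T)) \<longlonglongrightarrow> exp (L * T) * 0 * (D * card S + L * D * T)"
    by (intro tendsto_intros lim_const_over_n)
  then have "(\<lambda>n. exp (L * T) * (T / real n) * (D * card S + L * D * T)) \<longlonglongrightarrow> 0" by simp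
  moreover have "\<forall>\<^sub>F n in sequentially. norm (euler (T / real n) (\<lambda>k. \<sigma> (real k * (T / real n))) x n - Z T)
      \<le> exp (L * T) * (T / real n) * (D * card S + L * D * T)"
    using eventually_gt_at_top[of 0] by eventually_elim (use bound in auto)
  ultimately have "(\<lambda>n. euler (T / real n) (\<lambda>k. \<sigma> (real k * (T / real n))) x n - Z T) \<longlonglongrightarrow> 0"
    by (rule Lim_null_comparison[rotated])
  then show ?thesis by (simp add: LIM_zero_iff)
qed

end

section \<open>The transition operator of the Euler scheme\<close>

locale two_state_scheme = opposing_drifts +
  fixes p :: "nat \<Rightarrow> nat \<Rightarrow> real \<Rightarrow> real"
  assumes p_prob: "i \<in> {0, 1} \<Longrightarrow> h \<ge> 0 \<Longrightarrow> p i 0 h \<ge> 0 \<and> p i 1 h \<ge> 0 \<and> p i 0 h + p i 1 h = 1"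
    and p_rate: "i \<in> {0, 1} \<Longrightarrow> ((\<lambda>h. p i (1 - i) h / h) \<longlongrightarrow> l i) (at_right 0)"
begin

text \<open>
  The transition operator of the Markov chain that records the state and the position of the Euler
  scheme: the position moves with the present state, then the state jumps.
\<close>
definition one_step :: "real \<Rightarrow> (nat \<Rightarrow> real \<Rightarrow> real) \<Rightarrow> nat \<Rightarrow> real \<Rightarrow> real" where
  "one_step h w i y = p i 0 h * w 0 (y + h * drift i y) + p i 1 h * w 1 (y + h * drift i y)"

lemma rate_pos: "i \<in> {0, 1} \<Longrightarrow> l i > 0"
  using rates by auto

text \<open>
  The generator of the switched process maps \<open>w\<close> to \<open>g i + l i * (w (1 - i) - w i)\<close>, where
  \<open>g i = drift i * w i'\<close>.
\<close>
lemma one_step_generator: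
  assumes w: "\<And>i. i \<in> {0, 1} \<Longrightarrow> continuous_on UNIV (w i)"
    and g: "\<And>i. i \<in> {0, 1} \<Longrightarrow> continuous_on UNIV (g i)"
    and dw: "\<And>i y. i \<in> {0, 1} \<Longrightarrow> drift i y \<noteq> 0 \<Longrightarrow> (w i has_real_derivative g i y / drift i y) (at y)"
    and g0: "\<And>i y. i \<in> {0, 1} \<Longrightarrow> drift i y = 0 \<Longrightarrow> g i y = 0"
    and "\<epsilon> > 0"
  shows "\<forall>\<^sub>F h in at_right 0. \<forall>i\<in>{0, 1}. \<forall>y\<in>{a..b}.
    \<bar>one_step h w i y - w i y - h * (g i y + l i * (w (1 - i) y - w i y))\<bar> \<le> \<epsilon> * h"
proof (rule eventually_ball_finite)
  show "\<forall>i\<in>{0, 1}. \<forall>\<^sub>F h in at_right 0. \<forall>y\<in>{a..b}.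
    \<bar>one_step h w i y - w i y - h * (g i y + l i * (w (1 - i) y - w i y))\<bar> \<le> \<epsilon> * h"
  proof
    fix i :: nat assume i: "i \<in> {0, 1}"
    define N where "N = {a - 1..b + 1}"
    define \<Delta> where "\<Delta> y = w (1 - i) y - w i y" for y
    have cont: "continuous_on N \<Delta>"
      unfolding \<Delta>_def using i by (intro continuous_intros continuous_on_subset[OF w]) auto
    have "bounded (\<Delta> ` N)"
      by (intro compact_imp_bounded compact_continuous_image cont) (simp add: N_def)
    then obtain K where K: "K > 0" "\<And>y. y \<in> N \<Longrightarrow> \<bar>\<Delta> y\<bar> \<le> K"
      by (auto simp: bounded_pos)
    have "uniformly_continuous_on N \<Delta>"
      using cont by (rule compact_uniformly_continuous) (simp add: N_def)
    moreover have "\<epsilon> / (3 * l i) > 0" using \<open>\<epsilon> > 0\<close> rate_pos[OF i] by simp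
    ultimately obtain d where d: "d > 0"
        "\<And>y z. y \<in> N \<Longrightarrow> z \<in> N \<Longrightarrow> \<bar>z - y\<bar> < d \<Longrightarrow> \<bar>\<Delta> z - \<Delta> y\<bar> < \<epsilon> / (3 * l i)"
      unfolding uniformly_continuous_on_def dist_real_def by meson
    define D where "D = c 0 - c 1"
    have D: "D > 0" using c_order by (simp add: D_def)
    have "\<forall>\<^sub>F h in at_right 0. \<forall>y\<in>{a..b}. \<bar>w i (y + h * drift i y) - w i y - h * g i y\<bar> \<le> \<epsilon> / 3 * h"
      by (rule euler_increment[OF drift_lipschitz dw[OF i] g0[OF i] g[OF i]]) (use \<open>\<epsilon> > 0\<close> in auto)
    moreover have "\<forall>\<^sub>F h in at_right 0. dist (p i (1 - i) h / h) (l i) < \<epsilon> / (3 * K)"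
      using p_rate[OF i] K \<open>\<epsilon> > 0\<close> by (intro tendstoD) auto
    moreover have "\<forall>\<^sub>F h in at_right 0. (h::real) < min 1 d / D"
      by (rule order_tendstoD(2)[OF tendsto_ident_at]) (use d D in auto)
    moreover have "\<forall>\<^sub>F h in at_right 0. (h::real) > 0"
      by (simp add: eventually_at_right_less)
    ultimately show "\<forall>\<^sub>F h in at_right 0. \<forall>y\<in>{a..b}.
      \<bar>one_step h w i y - w i y - h * (g i y + l i * (w (1 - i) y - w i y))\<bar> \<le> \<epsilon> * h"
    proof eventually_elim
      case (elim h)
      show ?case
      proof
        fix y assume y: "y \<in> {a..b}"
        define z where "z = y + h * drift i y"
        define P where "P = p i (1 - i) h"
        have hD: "h * D < 1" "h * D < d" using elim(3) D by (auto simp: field_simps)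
        have "\<bar>z - y\<bar> \<le> h * D"
          using abs_drift_le[OF i, of y] elim(4) by (auto simp: z_def D_def abs_mult intro!: mult_left_mono)
        then have zy: "\<bar>z - y\<bar> < d" "z \<in> N" "y \<in> N"
          using hD y by (auto simp: N_def)
        have "one_step h w i y = w i z + P * \<Delta> z"
        proof -
          have "p i i h = 1 - P" using p_prob[OF i, of h] elim(4) i by (auto simp: P_def)
          moreover have "one_step h w i y = p i i h * w i z + P * w (1 - i) z"
            using i by (auto simp: one_step_def z_def P_def)
          ultimately have "one_step h w i y = (1 - P) * w i z + P * w (1 - i) z" by (simp only:)
          then show ?thesis unfolding \<Delta>_def by (simp only: algebra_simps)
        qed
        then have eq: "one_step h w i y - w i y - h * (g i y + l i * (w (1 - i) y - w i y))
          = (w i z - w i y - h * g i y) + (P - h * l i) * \<Delta> z + h * l i * (\<Delta> z - \<Delta> y)"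
          by (simp add: \<Delta>_def algebra_simps)
        \<comment> \<open>three errors: the Euler step, the switching probability, and the position of the switch\<close>
        have 1: "\<bar>w i z - w i y - h * g i y\<bar> \<le> \<epsilon> / 3 * h"
          using elim(1) y by (auto simp: z_def)
        have "\<bar>P / h - l i\<bar> \<le> \<epsilon> / (3 * K)" using elim(2) by (simp add: P_def dist_real_def)
        then have "\<bar>P / h - l i\<bar> * h \<le> \<epsilon> / (3 * K) * h"
          using elim(4) by (intro mult_right_mono) auto
        moreover have "\<bar>P / h - l i\<bar> * h = \<bar>P - h * l i\<bar>"
        proof -
          have "\<bar>P / h - l i\<bar> * h = \<bar>(P / h - l i) * h\<bar>" using elim(4) by (simp add: abs_mult)
          also have "(P / h - l i) * h = P - h * l i" using elim(4) by (simp add: field_simps)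
          finally show ?thesis .
        qed
        ultimately have "\<bar>P - h * l i\<bar> * \<bar>\<Delta> z\<bar> \<le> (\<epsilon> / (3 * K) * h) * K"
          using K(2)[OF zy(2)] \<open>\<epsilon> > 0\<close> K(1) elim(4) by (intro mult_mono) auto
        then have 2: "\<bar>(P - h * l i) * \<Delta> z\<bar> \<le> \<epsilon> / 3 * h"
          using K(1) by (simp add: abs_mult)
        have "h * l i * \<bar>\<Delta> z - \<Delta> y\<bar> \<le> h * l i * (\<epsilon> / (3 * l i))"
          using d(2)[OF zy(3,2,1)] elim(4) rate_pos[OF i] by (intro mult_left_mono) auto
        then have 3: "\<bar>h * l i * (\<Delta> z - \<Delta> y)\<bar> \<le> \<epsilon> / 3 * h"
          using rate_pos[OF i] elim(4) by (simp add: abs_mult)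
        show "\<bar>one_step h w i y - w i y - h * (g i y + l i * (w (1 - i) y - w i y))\<bar> \<le> \<epsilon> * h"
          unfolding eq using 1 2 3 by linarith
      qed
    qed
  qed
qed simp

lemma one_step_mono:
  assumes "i \<in> {0, 1}" "h \<ge> 0"
    and "\<And>j. j \<in> {0, 1} \<Longrightarrow> w j (y + h * drift i y) \<le> w' j (y + h * drift i y)"
  shows "one_step h w i y \<le> one_step h w' i y"
  unfolding one_step_def using p_prob[OF assms(1,2)] assms(3)
  by (intro add_mono mult_left_mono) auto

lemma one_step_affine:
  assumes "i \<in> {0, 1}" "h \<ge> 0"
  shows "one_step h (\<lambda>j z. a * w j z + b) i y = a * one_step h w i y + b"
proof -
  have "p i 1 h = 1 - p i 0 h" using p_prob[OF assms] by simp
  then show ?thesis by (simp only: one_step_def) (simp add: algebra_simps)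
qed

lemma iterate_almost_harmonic:
  assumes "h \<ge> 0" and e: "\<And>i y. i \<in> {0, 1} \<Longrightarrow> \<bar>one_step h w i y - w i y\<bar> \<le> e"
  shows "i \<in> {0, 1} \<Longrightarrow> \<bar>(one_step h ^^ n) w i y - w i y\<bar> \<le> real n * e"
proof (induction n arbitrary: i y)
  case (Suc n)
  let ?w = "(one_step h ^^ n) w"
  have IH: "?w j z \<le> 1 * w j z + real n * e" "1 * w j z + - (real n * e) \<le> ?w j z"
    if "j \<in> {0, 1}" for j z
    using Suc.IH[OF that, of z] by linarith+
  have "one_step h ?w i y \<le> one_step h (\<lambda>j z. 1 * w j z + real n * e) i y"
    by (intro one_step_mono[OF Suc.prems \<open>h \<ge> 0\<close>] IH)
  moreover have "one_step h (\<lambda>j z. 1 * w j z + - (real n * e)) i y \<le> one_step h ?w i y"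
    by (intro one_step_mono[OF Suc.prems \<open>h \<ge> 0\<close>] IH)
  ultimately show ?case
    using e[OF Suc.prems, of y] unfolding one_step_affine[OF Suc.prems \<open>h \<ge> 0\<close>]
    by (simp add: algebra_simps abs_le_iff)
qed simp

lemma iterate_contraction:
  assumes "h \<ge> 0" "\<theta> \<ge> 0" and v: "\<And>i y. i \<in> {0, 1} \<Longrightarrow> one_step h v i y \<le> \<theta> * v i y"
  shows "i \<in> {0, 1} \<Longrightarrow> (one_step h ^^ n) v i y \<le> \<theta> ^ n * v i y"
proof (induction n arbitrary: i y)
  case (Suc n)
  have "one_step h ((one_step h ^^ n) v) i y \<le> one_step h (\<lambda>j z. \<theta> ^ n * v j z + 0) i y"
    by (intro one_step_mono[OF Suc.prems \<open>h \<ge> 0\<close>]) (use Suc.IH in simp)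
  also have "\<dots> \<le> \<theta> ^ n * (\<theta> * v i y)"
    unfolding one_step_affine[OF Suc.prems \<open>h \<ge> 0\<close>]
    using v[OF Suc.prems, of y] \<open>\<theta> \<ge> 0\<close> by (auto intro: mult_left_mono)
  finally show ?case by (simp add: mult_ac)
qed simp

lemma eventually_step_size:
  assumes "\<forall>\<^sub>F h in at_right 0. P h" "T > 0"
  shows "\<forall>\<^sub>F n in sequentially. P (T / real n)"
proof -
  have "filterlim (\<lambda>n. T / real n) (at_right 0) sequentially"
    unfolding filterlim_at
  proof
    show "(\<lambda>n. T / real n) \<longlonglongrightarrow> 0" by (rule lim_const_over_n)
    show "\<forall>\<^sub>F n in sequentially. T / real n \<in> {0<..} \<and> T / real n \<noteq> 0"
      using eventually_gt_at_top[of 0] by eventually_elim (use \<open>T > 0\<close> in auto)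
  qed
  then show ?thesis using assms(1) unfolding filterlim_iff by blast
qed

lemma stays_out:
  assumes "i \<in> {0, 1}"
  shows "y \<le> \<alpha> \<Longrightarrow> h \<ge> 0 \<Longrightarrow> y + h * drift i y \<le> \<alpha>" "y \<ge> \<beta> \<Longrightarrow> h \<ge> 0 \<Longrightarrow> y + h * drift i y \<ge> \<beta>"
proof -
  show "y + h * drift i y \<le> \<alpha>" if "y \<le> \<alpha>" "h \<ge> 0"
    using that assms drift0_zero_iff[of y] mult_nonneg_nonpos[OF that(2) drift1_nonpos[of y]] by auto
  show "y + h * drift i y \<ge> \<beta>" if "y \<ge> \<beta>" "h \<ge> 0"
    using that assms drift1_zero_iff[of y] mult_nonneg_nonneg[OF that(2) drift0_nonneg[of y]] by auto
qed

text \<open>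
  A solution of the backward equations is changed by \<open>o(h)\<close> in one step inside the interval.  Outside
  nothing changes: there \<open>u\<close> is constant and the scheme does not return.  So \<open>n\<close> steps of size \<open>T / n\<close>
  contribute \<open>n * o(1 / n)\<close>.
\<close>
lemma iterate_exit_function:
  assumes cont: "\<And>i. i \<in> {0, 1} \<Longrightarrow> continuous_on UNIV (u i)"
    and left: "\<And>i y. i \<in> {0, 1} \<Longrightarrow> y \<le> \<alpha> \<Longrightarrow> u i y = 0"
    and right: "\<And>i y. i \<in> {0, 1} \<Longrightarrow> y \<ge> \<beta> \<Longrightarrow> u i y = 1"
    and du: "\<And>i y. i \<in> {0, 1} \<Longrightarrow> drift i y \<noteq> 0 \<Longrightarrow>
       (u i has_real_derivative l i * (u i y - u (1 - i) y) / drift i y) (at y)"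
    and T: "T > 0" and i: "i \<in> {0, 1}"
  shows "(\<lambda>n. (one_step (T / real n) ^^ n) u i x) \<longlonglongrightarrow> u i x"
proof (rule LIMSEQ_I)
  fix r :: real assume "r > 0"
  define \<epsilon> where "\<epsilon> = r / (2 * T)"
  have "\<epsilon> > 0" using T \<open>r > 0\<close> by (simp add: \<epsilon>_def)
  have "\<forall>\<^sub>F h in at_right 0. \<forall>i\<in>{0, 1}. \<forall>y\<in>{\<alpha>..\<beta>}.
    \<bar>one_step h u i y - u i y - h * (l i * (u i y - u (1 - i) y) + l i * (u (1 - i) y - u i y))\<bar> \<le> \<epsilon> * h"
  proof (rule one_step_generator[OF cont _ du])
    show "continuous_on UNIV (\<lambda>y. l i * (u i y - u (1 - i) y))" if "i \<in> {0, 1}" for i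
      using that by (intro continuous_intros cont) auto
    show "l i * (u i y - u (1 - i) y) = 0" if "i \<in> {0, 1}" "drift i y = 0" for i y
      using that drift0_zero_iff[of y] drift1_zero_iff[of y] left right by auto
  qed (use \<open>\<epsilon> > 0\<close> in auto)
  moreover have "\<forall>\<^sub>F h in at_right 0. (h::real) > 0"
    by (simp add: eventually_at_right_less)
  ultimately have "\<forall>\<^sub>F h in at_right 0. h > 0 \<and> (\<forall>i\<in>{0, 1}. \<forall>y. \<bar>one_step h u i y - u i y\<bar> \<le> \<epsilon> * h)"
  proof eventually_elim
    case (elim h)
    have "\<bar>one_step h u i y - u i y\<bar> \<le> \<epsilon> * h" if i: "i \<in> {0, 1}" for i y
    proof -
      consider "y \<in> {\<alpha>..\<beta>}" | "y \<le> \<alpha>" | "y \<ge> \<beta>" by fastforce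
      then show ?thesis
      proof cases
        case 1
        then show ?thesis using elim(1) i by (auto simp: algebra_simps)
      next
        case 2
        then show ?thesis using stays_out(1)[OF i 2, of h] left i elim(2) \<open>\<epsilon> > 0\<close> by (simp add: one_step_def)
      next
        case 3
        then show ?thesis using stays_out(2)[OF i 3, of h] right i elim(2) \<open>\<epsilon> > 0\<close> p_prob[OF i, of h]
          by (simp add: one_step_def)
      qed
    qed
    then show ?case using elim(2) by blast
  qed
  then have "\<forall>\<^sub>F n in sequentially. T / real n > 0 \<and>
      (\<forall>i\<in>{0, 1}. \<forall>y. \<bar>one_step (T / real n) u i y - u i y\<bar> \<le> \<epsilon> * (T / real n))"
    using T by (rule eventually_step_size)
  then have "\<forall>\<^sub>F n in sequentially. norm ((one_step (T / real n) ^^ n) u i x - u i x) < r"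
  proof eventually_elim
    case (elim n)
    then have "\<bar>(one_step (T / real n) ^^ n) u i x - u i x\<bar> \<le> real n * (\<epsilon> * (T / real n))"
      by (intro iterate_almost_harmonic i) auto
    also have "\<dots> = r / 2" using elim T by (cases "n = 0") (auto simp: \<epsilon>_def)
    finally show ?case using \<open>r > 0\<close> by simp
  qed
  then show "\<exists>no. \<forall>n\<ge>no. norm ((one_step (T / real n) ^^ n) u i x - u i x) < r"
    by (simp add: eventually_sequentially)
qed

text \<open>
  With \<open>\<zeta> i = exp (2 * l i * \<Phi> i)\<close> one has \<open>drift i * \<zeta> i' = 2 * l i * \<zeta> i\<close>, so the generator maps
  \<open>w i = C - \<zeta> i\<close> to \<open>- l i * (\<zeta> 0 + \<zeta> 1)\<close>.  The two functions \<open>\<zeta> 0\<close> and \<open>\<zeta> 1\<close> vanish at different ends of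
  the interval, hence this is bounded away from 0.  For large \<open>C\<close> the function \<open>w\<close> is positive near the
  interval, so setting it to 0 outside only lowers the average over one step; each step of size \<open>h\<close>
  then contracts by a factor \<open>1 - \<kappa> * h\<close>.
\<close>
lemma iterate_survival_function:
  assumes E: "exp_solutions E"
  obtains v K \<kappa> where "K > 0" "\<kappa> > 0"
    "\<And>i y. i \<in> {0, 1} \<Longrightarrow> v i y \<ge> indicat_real {\<alpha><..<\<beta>} y"
    "\<And>T i x. T > 0 \<Longrightarrow> i \<in> {0, 1} \<Longrightarrow>
       \<forall>\<^sub>F n in sequentially. (one_step (T / real n) ^^ n) v i x \<le> K * exp (- \<kappa> * T)"
    "\<And>i. i \<in> {0, 1} \<Longrightarrow> v i \<in> borel_measurable borel" "\<And>i y. i \<in> {0, 1} \<Longrightarrow> v i y \<le> K"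
proof -
  define \<zeta> where "\<zeta> i y = (E i y)\<^sup>2" for i y
  have contE: "continuous_on UNIV (E i)" if "i \<in> {0, 1}" for i
    using E that by (auto simp: exp_solutions_def)
  have Epos: "E i y > 0" if "i \<in> {0, 1}" "drift i y \<noteq> 0" for i y
    using E that by (auto simp: exp_solutions_def)
  have cont: "continuous_on UNIV (\<zeta> i)" if "i \<in> {0, 1}" for i
    unfolding \<zeta>_def using that by (intro continuous_intros contE)
  let ?N = "{\<alpha> - 1..\<beta> + 1}"
  have bdd: "\<exists>B. \<forall>y\<in>?N. \<zeta> i y \<le> B" if "i \<in> {0, 1}" for i
    using continuous_attains_sup[of ?N "\<zeta> i"] continuous_on_subset[OF cont[OF that]] ends by auto
  obtain B0 where B0: "\<forall>y\<in>?N. \<zeta> 0 y \<le> B0" using bdd[of 0] by blast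
  obtain B1 where B1: "\<forall>y\<in>?N. \<zeta> 1 y \<le> B1" using bdd[of 1] by blast
  define C where "C = max (max B0 B1) 0 + 1"
  have C: "\<zeta> i y + 1 \<le> C" if "i \<in> {0, 1}" "y \<in> ?N" for i y
    using that B0[rule_format, of y] B1[rule_format, of y] by (auto simp: C_def)
  have "C > 0" by (simp add: C_def)
  have \<zeta>0: "\<zeta> i y \<ge> 0" for i y by (simp add: \<zeta>_def)
  have "continuous_on {\<alpha>..\<beta>} (\<lambda>y. \<zeta> 0 y + \<zeta> 1 y)"
    by (intro continuous_intros continuous_on_subset[OF cont]) auto
  then obtain m where m: "m \<in> {\<alpha>..\<beta>}" "\<And>y. y \<in> {\<alpha>..\<beta>} \<Longrightarrow> \<zeta> 0 m + \<zeta> 1 m \<le> \<zeta> 0 y + \<zeta> 1 y"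
    using continuous_attains_inf[of "{\<alpha>..\<beta>}" "\<lambda>y. \<zeta> 0 y + \<zeta> 1 y"] ends by auto
  have "drift 0 m \<noteq> 0 \<or> drift 1 m \<noteq> 0"
    using drift0_zero_iff[of m] drift1_zero_iff[of m] ends by auto
  then have "\<zeta> 0 m > 0 \<or> \<zeta> 1 m > 0"
    using Epos[of 0 m] Epos[of 1 m] by (auto simp: \<zeta>_def)
  then have "\<zeta> 0 m + \<zeta> 1 m > 0" using \<zeta>0[of 0 m] \<zeta>0[of 1 m] by linarith
  \<comment> \<open>half of the decay; the other half absorbs the error of one step\<close>
  define k where "k = min (l 0) (l 1) * (\<zeta> 0 m + \<zeta> 1 m) / 2"
  have k: "k > 0" using rates \<open>\<zeta> 0 m + \<zeta> 1 m > 0\<close> by (simp add: k_def)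
  define w where "w i y = C - \<zeta> i y" for i y
  define v where "v i y = (if \<alpha> < y \<and> y < \<beta> then w i y else 0)" for i y
  define \<kappa> where "\<kappa> = k / C"
  have \<kappa>: "\<kappa> > 0" using k \<open>C > 0\<close> by (simp add: \<kappa>_def)
  have v_le: "v i y \<le> C" for i y using \<zeta>0[of i y] \<open>C > 0\<close> by (simp add: v_def w_def)
  have v_ind: "v i y \<ge> indicat_real {\<alpha><..<\<beta>} y" if "i \<in> {0, 1}" for i y
    using C[OF that, of y] by (auto simp: v_def w_def indicator_def)
  have v0: "v i y \<ge> 0" if "i \<in> {0, 1}" for i y
    by (rule order_trans[OF indicator_pos_le v_ind[OF that]])
  have "\<forall>\<^sub>F h in at_right 0. \<forall>i\<in>{0, 1}. \<forall>y\<in>{\<alpha>..\<beta>}.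
    \<bar>one_step h w i y - w i y - h * (- 2 * l i * \<zeta> i y + l i * (w (1 - i) y - w i y))\<bar> \<le> k * h"
  proof (rule one_step_generator)
    fix i :: nat and y assume i: "i \<in> {0, 1}"
    show "continuous_on UNIV (w i)" unfolding w_def using i by (intro continuous_intros cont)
    show "continuous_on UNIV (\<lambda>y. - 2 * l i * \<zeta> i y)" using i by (intro continuous_intros cont)
    show "- 2 * l i * \<zeta> i y = 0" if "drift i y = 0"
      using that E i by (auto simp: \<zeta>_def exp_solutions_def)
    show "(w i has_real_derivative - 2 * l i * \<zeta> i y / drift i y) (at y)" if "drift i y \<noteq> 0"
    proof -
      have "(E i has_real_derivative l i * E i y / drift i y) (at y)"
        using that E i by (auto simp: exp_solutions_def)
      then show ?thesis unfolding w_def \<zeta>_def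
        by (auto intro!: derivative_eq_intros simp: power2_eq_square)
    qed
  qed (rule k)
  moreover have "\<forall>\<^sub>F h in at_right 0. (h::real) > 0"
    by (simp add: eventually_at_right_less)
  moreover have "\<forall>\<^sub>F h in at_right 0. (h::real) < min (1 / (c 0 - c 1)) (1 / \<kappa>)"
    by (rule order_tendstoD(2)[OF tendsto_ident_at]) (use c_order \<kappa> in auto)
  ultimately have "\<forall>\<^sub>F h in at_right 0. h > 0 \<and> \<kappa> * h \<le> 1 \<and>
      (\<forall>i\<in>{0, 1}. \<forall>y. one_step h v i y \<le> (1 - \<kappa> * h) * v i y)"
  proof eventually_elim
    case (elim h)
    have "one_step h v i y \<le> (1 - \<kappa> * h) * v i y" if i: "i \<in> {0, 1}" for i y
    proof (cases "\<alpha> < y \<and> y < \<beta>")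
      case True
      have "h * \<bar>drift i y\<bar> \<le> h * (c 0 - c 1)"
        using abs_drift_le[OF i] elim(2) by (intro mult_left_mono) auto
      also have "\<dots> < 1" using elim(3) c_order by (simp add: field_simps)
      finally have "\<bar>h * drift i y\<bar> < 1" using elim(2) by (simp add: abs_mult)
      then have N: "y + h * drift i y \<in> ?N" using True by auto
      have "v j (y + h * drift i y) \<le> w j (y + h * drift i y)" if "j \<in> {0, 1}" for j
        using C[OF that N] by (auto simp: v_def w_def)
      then have "one_step h v i y \<le> one_step h w i y"
        using elim(2) by (intro one_step_mono i) auto
      also have "\<dots> \<le> w i y + h * (- 2 * l i * \<zeta> i y + l i * (w (1 - i) y - w i y)) + k * h"
        using elim(1) i True by (auto simp: abs_le_iff algebra_simps)
      also have "- 2 * l i * \<zeta> i y + l i * (w (1 - i) y - w i y) = - l i * (\<zeta> 0 y + \<zeta> 1 y)"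
        using i by (auto simp: w_def algebra_simps)
      also have "\<dots> \<le> - (min (l 0) (l 1) * (\<zeta> 0 m + \<zeta> 1 m))"
        using m(2)[of y] True i rates \<open>\<zeta> 0 m + \<zeta> 1 m > 0\<close> by (auto intro!: mult_mono)
      also have "\<dots> = - 2 * k" by (simp add: k_def)
      finally have "one_step h v i y \<le> w i y + h * (- 2 * k) + k * h"
        using elim(2) by (simp add: mult_left_mono)
      also have "\<dots> = v i y - k * h" using True by (simp add: v_def)
      also have "\<dots> \<le> v i y - \<kappa> * h * v i y"
      proof -
        have "\<kappa> * h * v i y \<le> \<kappa> * h * C" using v_le \<kappa> elim(2) by (intro mult_left_mono) auto
        then show ?thesis using \<open>C > 0\<close> by (simp add: \<kappa>_def)
      qed
      finally show ?thesis by (simp add: algebra_simps)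
    next
      case False
      then have "v j (y + h * drift i y) = 0" for j
        using stays_out[OF i, of y h] elim(2) by (auto simp: v_def)
      moreover have "v i y = 0" using False by (auto simp: v_def)
      ultimately show ?thesis by (simp add: one_step_def)
    qed
    then show ?case using elim(2,3) \<kappa> by (auto simp: field_simps)
  qed
  then have ev: "\<forall>\<^sub>F n in sequentially. T / real n > 0 \<and> \<kappa> * (T / real n) \<le> 1 \<and>
      (\<forall>i\<in>{0, 1}. \<forall>y. one_step (T / real n) v i y \<le> (1 - \<kappa> * (T / real n)) * v i y)" if "T > 0" for T
    using that by (rule eventually_step_size)
  show ?thesis
  proof (rule that[of C \<kappa> v])
    show "\<forall>\<^sub>F n in sequentially. (one_step (T / real n) ^^ n) v i x \<le> C * exp (- \<kappa> * T)"
      if T: "T > 0" and i: "i \<in> {0, 1}" for T i x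
      using ev[OF T]
    proof eventually_elim
      case (elim n)
      let ?\<theta> = "1 - \<kappa> * (T / real n)"
      have "(one_step (T / real n) ^^ n) v i x \<le> ?\<theta> ^ n * v i x"
        using elim by (intro iterate_contraction i) auto
      also have "\<dots> \<le> exp (- \<kappa> * (T / real n)) ^ n * C"
        using elim v_le v0[OF i] exp_ge_add_one_self[of "- \<kappa> * (T / real n)"]
        by (intro mult_mono power_mono) auto
      also have "exp (- \<kappa> * (T / real n)) ^ n = exp (- \<kappa> * T)"
        using elim by (cases "n = 0") (auto simp flip: exp_of_nat_mult)
      finally show ?case by (simp add: mult.commute)
    qed
    show "v i \<in> borel_measurable borel" if "i \<in> {0, 1}" for i
    proof -
      have "\<zeta> i \<in> borel_measurable borel"
        using cont[OF that] by (rule borel_measurable_continuous_onI)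
      then show ?thesis unfolding v_def w_def by measurable
    qed
  qed (use v_le v_ind \<kappa> \<open>C > 0\<close> in auto)
qed

end

section \<open>Expectations along the scheme and the exit probability\<close>

lemma (in finite_measure) integral_finite_range:
  fixes G :: "'s \<Rightarrow> real"
  assumes S: "finite S" "\<And>\<omega>. \<omega> \<in> space M \<Longrightarrow> f \<omega> \<in> S"
    and meas: "\<And>s. s \<in> S \<Longrightarrow> {\<omega>\<in>space M. f \<omega> = s} \<in> sets M"
  shows "(\<integral>\<omega>. G (f \<omega>) \<partial>M) = (\<Sum>s\<in>S. G s * measure M {\<omega>\<in>space M. f \<omega> = s})"
proof -
  have "(\<integral>\<omega>. G (f \<omega>) \<partial>M) = (\<integral>\<omega>. (\<Sum>s\<in>S. G s * indicat_real {\<omega>\<in>space M. f \<omega> = s} \<omega>) \<partial>M)"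
  proof (rule Bochner_Integration.integral_cong[OF refl])
    fix \<omega> assume \<omega>: "\<omega> \<in> space M"
    have "(\<Sum>s\<in>S. G s * indicat_real {\<omega>\<in>space M. f \<omega> = s} \<omega>) = (\<Sum>s\<in>S. if s = f \<omega> then G s else 0)"
      by (rule sum.cong) (use \<omega> in \<open>auto simp: indicator_def\<close>)
    also have "\<dots> = G (f \<omega>)" using S \<omega> by simp
    finally show "G (f \<omega>) = (\<Sum>s\<in>S. G s * indicat_real {\<omega>\<in>space M. f \<omega> = s} \<omega>)" by simp
  qed
  also have "\<dots> = (\<Sum>s\<in>S. \<integral>\<omega>. G s * indicat_real {\<omega>\<in>space M. f \<omega> = s} \<omega> \<partial>M)"
    using meas by (intro Bochner_Integration.integral_sum integrable_mult_right integrable_real_indicator)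
       (auto simp: emeasure_eq_measure)
  also have "\<dots> = (\<Sum>s\<in>S. G s * measure M {\<omega>\<in>space M. f \<omega> = s})"
    by (intro sum.cong) (auto intro!: arg_cong[of _ _ "measure M"])
  finally show ?thesis .
qed

lemma (in opposing_drifts) euler_cong:
  "(\<And>k. k < n \<Longrightarrow> s k = s' k) \<Longrightarrow> euler h s x n = euler h s' x n"
  by (induction n) auto

text \<open>
  The Markov property appears as a formula for joint probabilities at the grid times of the Euler
  scheme.  \<open>Z\<close> solves the equation with the clamped drift pathwise; as a limit of Euler schemes it is
  measurable.
\<close>
locale switched_process = two_state_scheme W c l L \<alpha> \<beta> p + prob_space M
  for W c l L \<alpha> \<beta> p and M :: "'w measure" +
  fixes \<xi> :: "real \<Rightarrow> 'w \<Rightarrow> nat" and x :: real and Z :: "real \<Rightarrow> 'w \<Rightarrow> real"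
  assumes \<xi>_measurable: "t \<ge> 0 \<Longrightarrow> \<xi> t \<in> measurable M (count_space UNIV)"
    and \<xi>_states: "t \<ge> 0 \<Longrightarrow> \<omega> \<in> space M \<Longrightarrow> \<xi> t \<omega> \<in> {0, 1}"
    and \<xi>_right: "\<omega> \<in> space M \<Longrightarrow> t \<ge> 0 \<Longrightarrow> \<forall>\<^sub>F s in at_right t. \<xi> s \<omega> = \<xi> t \<omega>"
    and \<xi>_left: "\<omega> \<in> space M \<Longrightarrow> t > 0 \<Longrightarrow> \<exists>j. \<forall>\<^sub>F s in at_left t. \<xi> s \<omega> = j"
    and \<xi>_markov: "h > 0 \<Longrightarrow> j \<in> {0, 1} \<Longrightarrow>
      prob {\<omega>\<in>space M. (\<forall>k\<le>n. \<xi> (real k * h) \<omega> = s k) \<and> \<xi> (real (Suc n) * h) \<omega> = j}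
      = p (s n) j h * prob {\<omega>\<in>space M. \<forall>k\<le>n. \<xi> (real k * h) \<omega> = s k}"
    and Z_solves: "\<omega> \<in> space M \<Longrightarrow> t \<ge> 0 \<Longrightarrow>
      ((\<lambda>r. drift (\<xi> r \<omega>) (Z r \<omega>)) has_integral (Z t \<omega> - x)) {0..t}"
begin

lemma state_event_measurable: "t \<ge> 0 \<Longrightarrow> {\<omega>\<in>space M. \<xi> t \<omega> = j} \<in> sets M"
  using measurable_sets[OF \<xi>_measurable, of t "{j}"] by (simp add: vimage_def Int_def conj_commute)

lemma history_event_measurable:
  "h \<ge> 0 \<Longrightarrow> {\<omega>\<in>space M. \<forall>k\<le>n. \<xi> (real k * h) \<omega> = s k} \<in> sets M"
proof -
  assume "h \<ge> 0"
  have "{\<omega>\<in>space M. \<forall>k\<in>{..n}. \<xi> (real k * h) \<omega> = s k} \<in> sets M"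
    by (intro sets.sets_Collect_finite_All state_event_measurable) (use \<open>h \<ge> 0\<close> in simp_all)
  then show ?thesis by (simp only: Ball_def atMost_iff)
qed

abbreviation scheme :: "real \<Rightarrow> nat \<Rightarrow> 'w \<Rightarrow> real" where
  "scheme h n \<omega> \<equiv> euler h (\<lambda>k. \<xi> (real k * h) \<omega>) x n"

text \<open>
  The position after step \<open>n + 1\<close> is determined by the states at the times \<open>0, h, \<dots>, n * h\<close>.  Given this
  history, only the next state is random.
\<close>
lemma expectation_one_step:
  assumes h: "h > 0"
  shows "(\<integral>\<omega>. w (\<xi> (real (Suc n) * h) \<omega>) (scheme h (Suc n) \<omega>) * of_bool (\<xi> 0 \<omega> = i) \<partial>M)
    = (\<integral>\<omega>. one_step h w (\<xi> (real n * h) \<omega>) (scheme h n \<omega>) * of_bool (\<xi> 0 \<omega> = i) \<partial>M)"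
proof -
  define H where "H \<omega> = restrict (\<lambda>k. \<xi> (real k * h) \<omega>) {..n}" for \<omega>
  define S where "S = ({..n} \<rightarrow>\<^sub>E {0, 1::nat})"
  have S: "finite S" by (auto simp: S_def intro!: finite_PiE)
  have HS: "H \<omega> \<in> S" if "\<omega> \<in> space M" for \<omega>
    using \<xi>_states[OF _ that] h by (auto simp: H_def S_def)
  have H_eq: "H \<omega> = s \<longleftrightarrow> (\<forall>k\<le>n. \<xi> (real k * h) \<omega> = s k)" if "s \<in> S" for s \<omega>
    using that by (auto simp: H_def S_def fun_eq_iff PiE_def extensional_def restrict_def)
  have H_event: "{\<omega>\<in>space M. H \<omega> = s} = {\<omega>\<in>space M. \<forall>k\<le>n. \<xi> (real k * h) \<omega> = s k}" if "s \<in> S" for s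
    using H_eq[OF that] by auto
  have euler_H: "euler h (H \<omega>) x m = scheme h m \<omega>" if "m \<le> Suc n" for m \<omega>
    by (rule euler_cong) (use that in \<open>auto simp: H_def\<close>)
  have H0: "H \<omega> 0 = \<xi> 0 \<omega>" and Hn: "H \<omega> n = \<xi> (real n * h) \<omega>" for \<omega> by (auto simp: H_def)
  define G1 where "G1 = (\<lambda>(s, j). w j (euler h s x (Suc n)) * of_bool (s 0 = i))"
  define G2 where "G2 s = one_step h w (s n) (euler h s x n) * of_bool (s 0 = i)" for s
  have "(\<integral>\<omega>. w (\<xi> (real (Suc n) * h) \<omega>) (scheme h (Suc n) \<omega>) * of_bool (\<xi> 0 \<omega> = i) \<partial>M)
    = (\<integral>\<omega>. G1 (H \<omega>, \<xi> (real (Suc n) * h) \<omega>) \<partial>M)"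
    by (simp only: G1_def prod.case euler_H[OF order_refl] H0)
  also have "\<dots> = (\<Sum>a\<in>S \<times> {0, 1}. G1 a * measure M {\<omega>\<in>space M. (H \<omega>, \<xi> (real (Suc n) * h) \<omega>) = a})"
  proof (rule integral_finite_range)
    fix a assume a: "a \<in> S \<times> {0, 1::nat}"
    then obtain s j where s: "s \<in> S" and "a = (s, j)" by blast
    then have "{\<omega>\<in>space M. (H \<omega>, \<xi> (real (Suc n) * h) \<omega>) = a}
      = {\<omega>\<in>space M. \<forall>k\<le>n. \<xi> (real k * h) \<omega> = s k} \<inter> {\<omega>\<in>space M. \<xi> (real (Suc n) * h) \<omega> = j}"
      using H_eq[OF s] by auto
    also have "\<dots> \<in> sets M"
      using h by (intro sets.Int history_event_measurable state_event_measurable) auto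
    finally show "{\<omega>\<in>space M. (H \<omega>, \<xi> (real (Suc n) * h) \<omega>) = a} \<in> sets M" .
  qed (use S HS \<xi>_states[of "real (Suc n) * h"] h in auto)
  also have "\<dots> = (\<Sum>s\<in>S. \<Sum>j\<in>{0, 1}. G1 (s, j) * (p (s n) j h * measure M {\<omega>\<in>space M. H \<omega> = s}))"
    unfolding sum.cartesian_product
  proof (rule sum.cong[OF refl])
    fix a assume "a \<in> S \<times> {0, 1::nat}"
    then obtain s j where s: "s \<in> S" and j: "j \<in> {0, 1}" and a: "a = (s, j)" by blast
    have "{\<omega>\<in>space M. (H \<omega>, \<xi> (real (Suc n) * h) \<omega>) = a}
      = {\<omega>\<in>space M. (\<forall>k\<le>n. \<xi> (real k * h) \<omega> = s k) \<and> \<xi> (real (Suc n) * h) \<omega> = j}"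
      using H_eq[OF s] a by auto
    then have "measure M {\<omega>\<in>space M. (H \<omega>, \<xi> (real (Suc n) * h) \<omega>) = a}
      = p (s n) j h * measure M {\<omega>\<in>space M. H \<omega> = s}"
      using \<xi>_markov[OF h j, of n s] by (simp only: H_event[OF s])
    then show "G1 a * measure M {\<omega>\<in>space M. (H \<omega>, \<xi> (real (Suc n) * h) \<omega>) = a}
      = (case a of (s, j) \<Rightarrow> G1 (s, j) * (p (s n) j h * measure M {\<omega>\<in>space M. H \<omega> = s}))"
      unfolding a by simp
  qed
  also have "\<dots> = (\<Sum>s\<in>S. G2 s * measure M {\<omega>\<in>space M. H \<omega> = s})"
    by (intro sum.cong refl) (simp add: G1_def G2_def one_step_def algebra_simps)
  also have "\<dots> = (\<integral>\<omega>. G2 (H \<omega>) \<partial>M)"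
  proof (rule integral_finite_range[OF S HS, symmetric])
    show "{\<omega>\<in>space M. H \<omega> = s} \<in> sets M" if "s \<in> S" for s
      unfolding H_event[OF that] using h by (intro history_event_measurable) simp
  qed
  also have "\<dots> = (\<integral>\<omega>. one_step h w (\<xi> (real n * h) \<omega>) (scheme h n \<omega>) * of_bool (\<xi> 0 \<omega> = i) \<partial>M)"
    by (simp only: G2_def euler_H[OF le_SucI[OF order_refl]] H0 Hn)
  finally show ?thesis .
qed

lemma expectation_scheme:
  assumes h: "h > 0"
  shows "(\<integral>\<omega>. w (\<xi> (real n * h) \<omega>) (scheme h n \<omega>) * of_bool (\<xi> 0 \<omega> = i) \<partial>M)
    = (one_step h ^^ n) w i x * prob {\<omega>\<in>space M. \<xi> 0 \<omega> = i}"
proof (induction n arbitrary: w)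
  case 0
  have "(\<integral>\<omega>. w (\<xi> 0 \<omega>) x * of_bool (\<xi> 0 \<omega> = i) \<partial>M)
    = (\<integral>\<omega>. w i x * indicat_real {\<omega>\<in>space M. \<xi> 0 \<omega> = i} \<omega> \<partial>M)"
    by (rule Bochner_Integration.integral_cong) (auto simp: indicator_def)
  also have "\<dots> = w i x * prob {\<omega>\<in>space M. \<xi> 0 \<omega> = i}"
    by (auto intro!: arg_cong[of _ _ prob])
  finally show ?case by simp
next
  case (Suc n)
  have "(one_step h ^^ Suc n) w = (one_step h ^^ n) (one_step h w)"
    by (simp add: funpow_swap1)
  then show ?case using expectation_one_step[OF h, of w n i] Suc.IH[of "one_step h w"] by simp
qed

lemma scheme_measurable: "h \<ge> 0 \<Longrightarrow> scheme h n \<in> borel_measurable M"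
proof (induction n)
  case (Suc n)
  have [measurable]: "W \<in> borel_measurable borel"
    using continuous_W by (rule borel_measurable_continuous_onI)
  have [measurable]: "scheme h n \<in> borel_measurable M" using Suc by simp
  have [measurable]: "(\<lambda>\<omega>. c (\<xi> (real n * h) \<omega>)) \<in> borel_measurable M"
    by (rule measurable_compose[OF \<xi>_measurable]) (use Suc.prems in auto)
  show ?case by (simp add: drift_def)
qed simp

lemma scheme_converges:
  assumes "\<omega> \<in> space M" "T > 0"
  shows "(\<lambda>n. scheme (T / real n) n \<omega>) \<longlonglongrightarrow> Z T \<omega>"
  using assms \<xi>_right \<xi>_left \<xi>_states Z_solves by (intro euler_converges) auto

lemma Z_measurable: "T > 0 \<Longrightarrow> Z T \<in> borel_measurable M"
  by (rule borel_measurable_LIMSEQ_real[OF scheme_converges scheme_measurable]) auto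

lemma state_dependent_measurable:
  assumes "t \<ge> 0" "Y \<in> borel_measurable M" "\<And>i. i \<in> {0, 1} \<Longrightarrow> w i \<in> borel_measurable borel"
  shows "(\<lambda>\<omega>. w (\<xi> t \<omega>) (Y \<omega>)) \<in> borel_measurable M"
proof (rule measurable_compose_countable'[of "{0, 1}" "\<lambda>i \<omega>. w i (Y \<omega>)" M borel "\<xi> t"])
  show "\<xi> t \<in> measurable M (count_space {0, 1})"
  proof (rule measurable_count_space_eq2[THEN iffD2])
    show "\<xi> t \<in> space M \<rightarrow> {0, 1} \<and> (\<forall>a\<in>{0, 1}. \<xi> t -` {a} \<inter> space M \<in> sets M)"
      using \<xi>_states measurable_sets[OF \<xi>_measurable] assms(1) by auto
  qed simp
qed (use assms in \<open>auto intro: measurable_compose\<close>)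

lemma weighted_measurable:
  fixes w :: "nat \<Rightarrow> real \<Rightarrow> real"
  assumes "t \<ge> 0" "Y \<in> borel_measurable M" "\<And>i. i \<in> {0, 1} \<Longrightarrow> w i \<in> borel_measurable borel"
  shows "(\<lambda>\<omega>. w (\<xi> t \<omega>) (Y \<omega>) * of_bool (\<xi> 0 \<omega> = i)) \<in> borel_measurable M"
proof (rule borel_measurable_times)
  show "(\<lambda>\<omega>. w (\<xi> t \<omega>) (Y \<omega>)) \<in> borel_measurable M"
    using assms by (rule state_dependent_measurable)
  show "(\<lambda>\<omega>. of_bool (\<xi> 0 \<omega> = i) :: real) \<in> borel_measurable M"
    by (rule measurable_compose[OF \<xi>_measurable]) auto
qed

lemma expectation_exit_function:
  assumes cont: "\<And>i. i \<in> {0, 1} \<Longrightarrow> continuous_on UNIV (u i)"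
    and left: "\<And>i y. i \<in> {0, 1} \<Longrightarrow> y \<le> \<alpha> \<Longrightarrow> u i y = 0"
    and right: "\<And>i y. i \<in> {0, 1} \<Longrightarrow> y \<ge> \<beta> \<Longrightarrow> u i y = 1"
    and du: "\<And>i y. i \<in> {0, 1} \<Longrightarrow> drift i y \<noteq> 0 \<Longrightarrow>
       (u i has_real_derivative l i * (u i y - u (1 - i) y) / drift i y) (at y)"
    and K: "\<And>i y. i \<in> {0, 1} \<Longrightarrow> \<bar>u i y\<bar> \<le> K"
    and T: "T > 0" and i: "i \<in> {0, 1}"
  shows "(\<integral>\<omega>. u (\<xi> T \<omega>) (Z T \<omega>) * of_bool (\<xi> 0 \<omega> = i) \<partial>M) = u i x * prob {\<omega>\<in>space M. \<xi> 0 \<omega> = i}"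
proof (rule LIMSEQ_unique)
  let ?f = "\<lambda>n \<omega>. u (\<xi> T \<omega>) (scheme (T / real n) n \<omega>) * of_bool (\<xi> 0 \<omega> = i)"
  have u_meas: "u i \<in> borel_measurable borel" if "i \<in> {0, 1}" for i
    using cont[OF that] by (rule borel_measurable_continuous_onI)
  show "(\<lambda>n. \<integral>\<omega>. ?f n \<omega> \<partial>M) \<longlonglongrightarrow> (\<integral>\<omega>. u (\<xi> T \<omega>) (Z T \<omega>) * of_bool (\<xi> 0 \<omega> = i) \<partial>M)"
  proof (rule integral_dominated_convergence[where w = "\<lambda>_. K"])
    show "(\<lambda>\<omega>. u (\<xi> T \<omega>) (Z T \<omega>) * of_bool (\<xi> 0 \<omega> = i)) \<in> borel_measurable M"
      by (rule weighted_measurable[OF less_imp_le[OF T] Z_measurable[OF T] u_meas])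
    show "?f n \<in> borel_measurable M" for n
      by (rule weighted_measurable[OF less_imp_le[OF T] scheme_measurable u_meas]) (use T in auto)
    show "AE \<omega> in M. (\<lambda>n. ?f n \<omega>) \<longlonglongrightarrow> u (\<xi> T \<omega>) (Z T \<omega>) * of_bool (\<xi> 0 \<omega> = i)"
    proof (rule AE_I2)
      fix \<omega> assume \<omega>: "\<omega> \<in> space M"
      have "isCont (u (\<xi> T \<omega>)) (Z T \<omega>)"
        using cont[OF \<xi>_states[OF _ \<omega>]] T by (simp add: continuous_on_eq_continuous_at)
      then show "(\<lambda>n. ?f n \<omega>) \<longlonglongrightarrow> u (\<xi> T \<omega>) (Z T \<omega>) * of_bool (\<xi> 0 \<omega> = i)"
        by (intro tendsto_mult tendsto_const isCont_tendsto_compose[OF _ scheme_converges[OF \<omega> T]])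
    qed
    show "AE \<omega> in M. norm (?f n \<omega>) \<le> K" for n
    proof (rule AE_I2)
      fix \<omega> assume \<omega>: "\<omega> \<in> space M"
      have "\<bar>u (\<xi> T \<omega>) (scheme (T / real n) n \<omega>)\<bar> \<le> K"
        using K[OF \<xi>_states[OF _ \<omega>]] T by auto
      then show "norm (?f n \<omega>) \<le> K"
        using abs_ge_zero order_trans by (auto simp: abs_mult)
    qed
  qed auto
  show "(\<lambda>n. \<integral>\<omega>. ?f n \<omega> \<partial>M) \<longlonglongrightarrow> u i x * prob {\<omega>\<in>space M. \<xi> 0 \<omega> = i}"
  proof (rule Lim_transform_eventually)
    show "(\<lambda>n. (one_step (T / real n) ^^ n) u i x * prob {\<omega>\<in>space M. \<xi> 0 \<omega> = i})
        \<longlonglongrightarrow> u i x * prob {\<omega>\<in>space M. \<xi> 0 \<omega> = i}"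
      by (intro tendsto_mult tendsto_const iterate_exit_function assms)
    show "\<forall>\<^sub>F n in sequentially. (one_step (T / real n) ^^ n) u i x * prob {\<omega>\<in>space M. \<xi> 0 \<omega> = i}
        = (\<integral>\<omega>. ?f n \<omega> \<partial>M)"
      using eventually_gt_at_top[of 0]
    proof eventually_elim
      case (elim n)
      then show ?case using expectation_scheme[of "T / real n" u n i] T by simp
    qed
  qed
qed

text \<open>
  A path that is inside the open interval at time \<open>T\<close> is the limit of Euler schemes that are eventually
  inside, so the bound for the schemes passes to the limit.
\<close>
lemma survival_probability_le:
  assumes E: "exp_solutions E"
  obtains K \<kappa> where "\<kappa> > 0" "\<And>T i. T > 0 \<Longrightarrow> i \<in> {0, 1} \<Longrightarrow>
    prob {\<omega>\<in>space M. \<xi> 0 \<omega> = i \<and> \<alpha> < Z T \<omega> \<and> Z T \<omega> < \<beta>} \<le> K * exp (- \<kappa> * T)"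
proof -
  obtain v K \<kappa> where K: "K > 0" and \<kappa>: "\<kappa> > 0"
    and v: "\<And>i y. i \<in> {0, 1} \<Longrightarrow> v i y \<ge> indicat_real {\<alpha><..<\<beta>} y"
    and decay: "\<And>T i x. T > 0 \<Longrightarrow> i \<in> {0, 1} \<Longrightarrow>
       \<forall>\<^sub>F n in sequentially. (one_step (T / real n) ^^ n) v i x \<le> K * exp (- \<kappa> * T)"
    and vm: "\<And>i. i \<in> {0, 1} \<Longrightarrow> v i \<in> borel_measurable borel"
    and vK: "\<And>i y. i \<in> {0, 1} \<Longrightarrow> v i y \<le> K"
    by (rule iterate_survival_function[OF E]) (rule that, assumption+)
  have v0: "v i y \<ge> 0" if "i \<in> {0, 1}" for i y
    by (rule order_trans[OF indicator_pos_le v[OF that]])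
  have "prob {\<omega>\<in>space M. \<xi> 0 \<omega> = i \<and> \<alpha> < Z T \<omega> \<and> Z T \<omega> < \<beta>} \<le> K * exp (- \<kappa> * T)"
    if T: "T > 0" and i: "i \<in> {0, 1}" for T i
  proof -
    define A where "A n = {\<omega>\<in>space M. \<xi> 0 \<omega> = i \<and> scheme (T / real n) n \<omega> \<in> {\<alpha><..<\<beta>}}" for n
    have A[measurable]: "A n \<in> sets M" for n
    proof -
      have "scheme (T / real n) n \<in> borel_measurable M"
        by (rule scheme_measurable) (use T in auto)
      then have "{\<omega>\<in>space M. scheme (T / real n) n \<omega> \<in> {\<alpha><..<\<beta>}} \<in> sets M"
        using measurable_sets[of "scheme (T / real n) n" M borel "{\<alpha><..<\<beta>}"]
        by (simp only: vimage_def Int_def conj_commute mem_Collect_eq) auto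
      moreover have "A n = {\<omega>\<in>space M. \<xi> 0 \<omega> = i} \<inter> {\<omega>\<in>space M. scheme (T / real n) n \<omega> \<in> {\<alpha><..<\<beta>}}"
        by (auto simp: A_def)
      ultimately show ?thesis using state_event_measurable[of 0 i] by auto
    qed
    have PA: "prob (A n) \<le> (one_step (T / real n) ^^ n) v i x" if "n > 0" for n
    proof -
      let ?f = "\<lambda>\<omega>. v (\<xi> T \<omega>) (scheme (T / real n) n \<omega>) * of_bool (\<xi> 0 \<omega> = i)"
      have f_meas: "?f \<in> borel_measurable M"
        by (rule weighted_measurable[OF less_imp_le[OF T] scheme_measurable vm]) (use T in auto)
      have st: "\<xi> T \<omega> \<in> {0, 1}" if "\<omega> \<in> space M" for \<omega> using \<xi>_states[OF _ that] T by auto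
      have f_bound: "0 \<le> ?f \<omega> \<and> ?f \<omega> \<le> K" if "\<omega> \<in> space M" for \<omega>
        using v0[OF st[OF that]] vK[OF st[OF that]] K by auto
      have "prob (A n) = (\<integral>\<omega>. indicat_real (A n) \<omega> \<partial>M)"
        using sets.sets_into_space[OF A] by (simp add: Int_absorb2)
      also have "\<dots> \<le> (\<integral>\<omega>. ?f \<omega> \<partial>M)"
      proof (rule integral_mono)
        show "integrable M ?f"
          using f_bound f_meas by (intro integrable_const_bound[of _ K]) auto
        show "indicat_real (A n) \<omega> \<le> ?f \<omega>" if "\<omega> \<in> space M" for \<omega>
          using v[OF st[OF that], of "scheme (T / real n) n \<omega>"] f_bound[OF that]
          by (auto simp: A_def indicator_def split: if_splits)
      qed (auto simp: integrable_real_indicator emeasure_eq_measure)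
      also have "\<dots> = (one_step (T / real n) ^^ n) v i x * prob {\<omega>\<in>space M. \<xi> 0 \<omega> = i}"
        using expectation_scheme[of "T / real n" v n i] T that by simp
      finally have *: "prob (A n) \<le> (one_step (T / real n) ^^ n) v i x * prob {\<omega>\<in>space M. \<xi> 0 \<omega> = i}" .
      show ?thesis
      proof (cases "(one_step (T / real n) ^^ n) v i x \<ge> 0")
        case True
        then show ?thesis using * mult_left_le[OF prob_le_1 True] order_trans by blast
      next
        case False
        then have "(one_step (T / real n) ^^ n) v i x * prob {\<omega>\<in>space M. \<xi> 0 \<omega> = i} \<le> 0"
          by (intro mult_nonpos_nonneg) auto
        then have P0: "prob (A n) = 0" using * measure_nonneg[of M "A n"] by linarith
        have "(one_step (T / real n) ^^ m) v j y \<ge> 0" if "j \<in> {0, 1}" for m j y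
          using that
        proof (induction m arbitrary: j y)
          case (Suc m)
          then show ?case using p_prob[of j "T / real n"] T by (auto simp: one_step_def)
        qed (use v0 in auto)
        then show ?thesis using P0 i by auto
      qed
    qed
    define A' where "A' N = (\<Inter>n\<in>{N..}. A n)" for N
    have "prob {\<omega>\<in>space M. \<xi> 0 \<omega> = i \<and> \<alpha> < Z T \<omega> \<and> Z T \<omega> < \<beta>} \<le> prob (\<Union>N. A' N)"
    proof (rule finite_measure_mono)
      show "{\<omega>\<in>space M. \<xi> 0 \<omega> = i \<and> \<alpha> < Z T \<omega> \<and> Z T \<omega> < \<beta>} \<subseteq> (\<Union>N. A' N)"
      proof safe
        fix \<omega> assume \<omega>: "\<omega> \<in> space M" "\<alpha> < Z T \<omega>" "Z T \<omega> < \<beta>" "i = \<xi> 0 \<omega>"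
        have "\<forall>\<^sub>F n in sequentially. scheme (T / real n) n \<omega> \<in> {\<alpha><..<\<beta>}"
          using scheme_converges[OF \<omega>(1) T] \<omega>(2,3) by (intro topological_tendstoD) auto
        then obtain N where "\<And>n. n \<ge> N \<Longrightarrow> scheme (T / real n) n \<omega> \<in> {\<alpha><..<\<beta>}"
          by (auto simp: eventually_sequentially)
        then have "\<omega> \<in> A' N" using \<omega> by (auto simp: A'_def A_def)
        then show "\<omega> \<in> (\<Union>N. A' N)" by blast
      qed
    qed (auto simp: A'_def)
    also have "\<dots> \<le> K * exp (- \<kappa> * T)"
    proof (rule LIMSEQ_le_const2)
      show "(\<lambda>N. prob (A' N)) \<longlonglongrightarrow> prob (\<Union>N. A' N)"
        by (rule finite_Lim_measure_incseq) (auto simp: A'_def incseq_def)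
      have "prob (A' N) \<le> K * exp (- \<kappa> * T)" for N
      proof -
        have "\<forall>\<^sub>F n in sequentially. n \<ge> max N 1 \<and> (one_step (T / real n) ^^ n) v i x \<le> K * exp (- \<kappa> * T)"
          using decay[OF T i, of x] eventually_ge_at_top[of "max N 1"] by eventually_elim auto
        then obtain n where n: "n \<ge> max N 1" "(one_step (T / real n) ^^ n) v i x \<le> K * exp (- \<kappa> * T)"
          using eventually_happens'[OF sequentially_bot] by blast
        have "prob (A' N) \<le> prob (A n)"
          using n by (intro finite_measure_mono) (auto simp: A'_def)
        then show ?thesis using PA[of n] n by auto
      qed
      then show "\<exists>N. \<forall>n\<ge>N. prob (A' n) \<le> K * exp (- \<kappa> * T)" by blast
    qed
    finally show ?thesis .
  qed
  then show ?thesis using that[OF \<kappa>] by blast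
qed

text \<open>
  Given \<open>\<xi> 0 = i\<close>, the value \<open>u (\<xi> t) (Z t)\<close> at \<open>t = n + 1\<close> agrees with the indicator of \<open>R n\<close> unless the
  path is still inside, which is exponentially unlikely; its expectation does not depend on \<open>n\<close>.
\<close>
lemma exit_probability:
  assumes E: "exp_solutions E"
    and cont: "\<And>i. i \<in> {0, 1} \<Longrightarrow> continuous_on UNIV (u i)"
    and left: "\<And>i y. i \<in> {0, 1} \<Longrightarrow> y \<le> \<alpha> \<Longrightarrow> u i y = 0"
    and right: "\<And>i y. i \<in> {0, 1} \<Longrightarrow> y \<ge> \<beta> \<Longrightarrow> u i y = 1"
    and du: "\<And>i y. i \<in> {0, 1} \<Longrightarrow> drift i y \<noteq> 0 \<Longrightarrow>
       (u i has_real_derivative l i * (u i y - u (1 - i) y) / drift i y) (at y)"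
    and absorbed: "\<And>\<omega> s t. \<omega> \<in> space M \<Longrightarrow> 0 \<le> s \<Longrightarrow> s \<le> t \<Longrightarrow> Z s \<omega> \<ge> \<beta> \<Longrightarrow> Z t \<omega> \<ge> \<beta>"
    and i: "i \<in> {0, 1}"
  shows "prob {\<omega>\<in>space M. \<xi> 0 \<omega> = i \<and> (\<exists>t\<ge>0. Z t \<omega> \<ge> \<beta>)} = u i x * prob {\<omega>\<in>space M. \<xi> 0 \<omega> = i}"
proof -
  have "\<exists>B. \<forall>y. \<bar>u i y\<bar> \<le> B" if i: "i \<in> {0, 1}" for i
  proof -
    have "bounded (u i ` {\<alpha>..\<beta>})"
      by (intro compact_imp_bounded compact_continuous_image continuous_on_subset[OF cont[OF i]]) auto
    then obtain B where B: "\<forall>y\<in>{\<alpha>..\<beta>}. \<bar>u i y\<bar> \<le> B" by (auto simp: bounded_iff)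
    have "\<bar>u i y\<bar> \<le> max B 1" for y
      using B[rule_format, of y] left[OF i, of y] right[OF i, of y] by (cases "y \<le> \<alpha>"; cases "y \<ge> \<beta>") auto
    then show ?thesis by blast
  qed
  from this[of 0] this[of 1] obtain B0 B1 where "\<And>y. \<bar>u 0 y\<bar> \<le> B0" "\<And>y. \<bar>u 1 y\<bar> \<le> B1" by auto
  then have "\<exists>K. \<forall>i\<in>{0, 1}. \<forall>y. \<bar>u i y\<bar> \<le> K"
    by (intro exI[of _ "max B0 B1"]) (auto simp: le_max_iff_disj)
  then obtain K where K: "\<And>i y. i \<in> {0, 1} \<Longrightarrow> \<bar>u i y\<bar> \<le> K" by blast
  obtain C \<kappa> where \<kappa>: "\<kappa> > 0" and surv: "\<And>T i. T > 0 \<Longrightarrow> i \<in> {0, 1} \<Longrightarrow>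
    prob {\<omega>\<in>space M. \<xi> 0 \<omega> = i \<and> \<alpha> < Z T \<omega> \<and> Z T \<omega> < \<beta>} \<le> C * exp (- \<kappa> * T)"
    by (rule survival_probability_le[OF E]) (rule that, assumption+)
  define R where "R n = {\<omega>\<in>space M. \<xi> 0 \<omega> = i \<and> Z (real (Suc n)) \<omega> \<ge> \<beta>}" for n
  define I where "I n = {\<omega>\<in>space M. \<xi> 0 \<omega> = i \<and> \<alpha> < Z (real (Suc n)) \<omega> \<and> Z (real (Suc n)) \<omega> < \<beta>}" for n
  have Zm: "Z (real (Suc n)) \<in> borel_measurable M" for n by (rule Z_measurable) simp
  have R[measurable]: "R n \<in> sets M" for n
  proof -
    have "{\<omega>\<in>space M. Z (real (Suc n)) \<omega> \<ge> \<beta>} \<in> sets M" using Zm[of n] by measurable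
    moreover have "R n = {\<omega>\<in>space M. \<xi> 0 \<omega> = i} \<inter> {\<omega>\<in>space M. Z (real (Suc n)) \<omega> \<ge> \<beta>}" by (auto simp: R_def)
    ultimately show ?thesis using state_event_measurable[of 0 i] by auto
  qed
  have I[measurable]: "I n \<in> sets M" for n
  proof -
    have "{\<omega>\<in>space M. \<alpha> < Z (real (Suc n)) \<omega> \<and> Z (real (Suc n)) \<omega> < \<beta>} \<in> sets M" using Zm[of n] by measurable
    moreover have "I n = {\<omega>\<in>space M. \<xi> 0 \<omega> = i} \<inter> {\<omega>\<in>space M. \<alpha> < Z (real (Suc n)) \<omega> \<and> Z (real (Suc n)) \<omega> < \<beta>}"
      by (auto simp: I_def)
    ultimately show ?thesis using state_event_measurable[of 0 i] by auto
  qed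
  have close: "\<bar>u i x * prob {\<omega>\<in>space M. \<xi> 0 \<omega> = i} - prob (R n)\<bar> \<le> K * (C * exp (- \<kappa> * real (Suc n)))" for n
  proof -
    let ?T = "real (Suc n)"
    let ?f = "\<lambda>\<omega>. u (\<xi> ?T \<omega>) (Z ?T \<omega>) * of_bool (\<xi> 0 \<omega> = i)"
    have st: "\<xi> ?T \<omega> \<in> {0, 1}" if "\<omega> \<in> space M" for \<omega> using \<xi>_states[OF _ that] by auto
    have K0: "K \<ge> 0" using K[of 0 0] by auto
    have f_int: "integrable M ?f"
    proof (rule integrable_const_bound[of _ K])
      show "?f \<in> borel_measurable M"
        by (rule weighted_measurable[OF _ Zm borel_measurable_continuous_onI[OF cont]]) auto
      show "AE \<omega> in M. norm (?f \<omega>) \<le> K"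
        using K[OF st] K0 by (intro AE_I2) (auto simp: abs_mult)
    qed
    have int_ind: "integrable M (indicat_real A)" if "A \<in> sets M" for A
      using that by (simp add: integrable_real_indicator emeasure_eq_measure)
    have prob_eq: "prob A = (\<integral>\<omega>. indicat_real A \<omega> \<partial>M)" if "A \<in> sets M" for A
      using sets.sets_into_space[OF that] by (simp add: Int_absorb2)
    have "u i x * prob {\<omega>\<in>space M. \<xi> 0 \<omega> = i} - prob (R n) = (\<integral>\<omega>. ?f \<omega> - indicat_real (R n) \<omega> \<partial>M)"
    proof -
      have "(\<integral>\<omega>. ?f \<omega> - indicat_real (R n) \<omega> \<partial>M) = (\<integral>\<omega>. ?f \<omega> \<partial>M) - (\<integral>\<omega>. indicat_real (R n) \<omega> \<partial>M)"
        by (rule Bochner_Integration.integral_diff[OF f_int int_ind[OF R]])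
      also have "(\<integral>\<omega>. ?f \<omega> \<partial>M) = u i x * prob {\<omega>\<in>space M. \<xi> 0 \<omega> = i}"
        by (rule expectation_exit_function[OF cont left right du K _ i]) auto
      also have "(\<integral>\<omega>. indicat_real (R n) \<omega> \<partial>M) = prob (R n)"
        by (rule prob_eq[OF R, symmetric])
      finally show ?thesis by simp
    qed
    also have "\<bar>\<dots>\<bar> \<le> (\<integral>\<omega>. \<bar>?f \<omega> - indicat_real (R n) \<omega>\<bar> \<partial>M)"
      by (rule integral_abs_bound)
    also have "\<dots> \<le> (\<integral>\<omega>. K * indicat_real (I n) \<omega> \<partial>M)"
    proof (rule integral_mono)
      show "\<bar>?f \<omega> - indicat_real (R n) \<omega>\<bar> \<le> K * indicat_real (I n) \<omega>" if \<omega>: "\<omega> \<in> space M" for \<omega>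
      proof -
        consider "Z ?T \<omega> \<le> \<alpha>" | "Z ?T \<omega> \<ge> \<beta>" | "\<alpha> < Z ?T \<omega>" "Z ?T \<omega> < \<beta>" by linarith
        then show ?thesis
        proof cases
          case 1
          then have "indicat_real (R n) \<omega> = 0" using ends by (auto simp: R_def indicator_def)
          then show ?thesis using left[OF st[OF \<omega>] 1] K0 by simp
        next
          case 2
          then have "indicat_real (R n) \<omega> = of_bool (\<xi> 0 \<omega> = i)" using \<omega> by (auto simp: R_def indicator_def)
          then show ?thesis using right[OF st[OF \<omega>] 2] K0 by simp
        next
          case 3
          then have "indicat_real (R n) \<omega> = 0" "indicat_real (I n) \<omega> = of_bool (\<xi> 0 \<omega> = i)"
            using \<omega> by (auto simp: R_def I_def indicator_def)
          then show ?thesis using K[OF st[OF \<omega>], of "Z ?T \<omega>"] by (auto simp: abs_mult)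
        qed
      qed
    qed (use f_int int_ind I R in auto)
    also have "\<dots> = K * prob (I n)" by (simp only: integral_mult_right_zero prob_eq[OF I])
    also have "\<dots> \<le> K * (C * exp (- \<kappa> * ?T))"
      using surv[of ?T i] i K0 unfolding I_def by (intro mult_left_mono) auto
    finally show ?thesis .
  qed
  have "(\<lambda>n. u i x * prob {\<omega>\<in>space M. \<xi> 0 \<omega> = i} - prob (R n)) \<longlonglongrightarrow> 0"
  proof (rule Lim_null_comparison)
    show "\<forall>\<^sub>F n in sequentially. norm (u i x * prob {\<omega>\<in>space M. \<xi> 0 \<omega> = i} - prob (R n))
        \<le> K * (C * exp (- \<kappa> * real (Suc n)))"
      using close by (intro always_eventually) auto
    have "(\<lambda>n. K * (C * exp (- \<kappa> * real n))) \<longlonglongrightarrow> 0"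
      using \<kappa> by real_asymp
    then show "(\<lambda>n. K * (C * exp (- \<kappa> * real (Suc n)))) \<longlonglongrightarrow> 0"
      by (rule LIMSEQ_Suc)
  qed
  from tendsto_diff[OF tendsto_const[of "u i x * prob {\<omega>\<in>space M. \<xi> 0 \<omega> = i}"] this]
  have lim_u: "(\<lambda>n. prob (R n)) \<longlonglongrightarrow> u i x * prob {\<omega>\<in>space M. \<xi> 0 \<omega> = i}"
    by simp
  have lim_R: "(\<lambda>n. prob (R n)) \<longlonglongrightarrow> prob (\<Union>n. R n)"
  proof (rule finite_Lim_measure_incseq)
    show "incseq R"
    proof (rule incseq_SucI, rule subsetI)
      fix n \<omega> assume "\<omega> \<in> R n"
      then show "\<omega> \<in> R (Suc n)"
        using absorbed[of \<omega> "real (Suc n)" "real (Suc (Suc n))"] by (simp add: R_def)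
    qed
    show "range R \<subseteq> sets M" using R by blast
  qed
  have "(\<Union>n. R n) = {\<omega>\<in>space M. \<xi> 0 \<omega> = i \<and> (\<exists>t\<ge>0. Z t \<omega> \<ge> \<beta>)}"
  proof (intro set_eqI iffI)
    fix \<omega> assume "\<omega> \<in> (\<Union>n. R n)"
    then obtain n where "\<omega> \<in> space M" "\<xi> 0 \<omega> = i" "Z (real (Suc n)) \<omega> \<ge> \<beta>"
      unfolding R_def by blast
    moreover have "real (Suc n) \<ge> 0" by simp
    ultimately show "\<omega> \<in> {\<omega>\<in>space M. \<xi> 0 \<omega> = i \<and> (\<exists>t\<ge>0. Z t \<omega> \<ge> \<beta>)}" by blast
  next
    fix \<omega> assume "\<omega> \<in> {\<omega>\<in>space M. \<xi> 0 \<omega> = i \<and> (\<exists>t\<ge>0. Z t \<omega> \<ge> \<beta>)}"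
    then obtain t where \<omega>: "\<omega> \<in> space M" "\<xi> 0 \<omega> = i" "t \<ge> 0" "Z t \<omega> \<ge> \<beta>" by blast
    obtain n where "t \<le> real n" using real_arch_simple by blast
    then have "t \<le> real (Suc n)" by simp
    then have "\<omega> \<in> R n" using absorbed[OF \<omega>(1,3) _ \<omega>(4)] \<omega>(1,2) unfolding R_def by blast
    then show "\<omega> \<in> (\<Union>n. R n)" by blast
  qed
  then show ?thesis using LIMSEQ_unique[OF lim_R lim_u] by (simp only:)
qed

end

section \<open>Reduction to the clamped drift\<close>

lemma continuous_on_primitive:
  fixes X v :: "real \<Rightarrow> real"
  assumes "\<And>t. t \<ge> 0 \<Longrightarrow> (v has_integral (X t - x)) {0..t}"
  shows "continuous_on {0..t} X"
proof (cases "t \<ge> 0")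
  case True
  have "continuous_on {0..t} (\<lambda>s. x + integral {0..s} v)"
    using assms[OF True] by (intro continuous_intros indefinite_integral_continuous_1) auto
  moreover have "x + integral {0..s} v = X s" if "s \<in> {0..t}" for s
    using integral_unique[OF assms[of s]] that by simp
  ultimately show ?thesis by (rule continuous_on_eq)
qed simp

text \<open>
  One-sided uniqueness at an equilibrium \<open>e\<close> of \<open>g\<close>: just after the last time at \<open>e\<close> the maximal excess
  \<open>m\<close> over \<open>e\<close> would satisfy \<open>m \<le> m / 2\<close>.
\<close>
lemma stays_below_equilibrium:
  fixes X v g g' :: "real \<Rightarrow> real"
  assumes int: "\<And>t. t \<ge> 0 \<Longrightarrow> (v has_integral (X t - x)) {0..t}"
    and v: "\<And>s. s \<ge> 0 \<Longrightarrow> v s \<le> g (X s)"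
    and g: "\<And>y. (g has_real_derivative g' y) (at y)" "continuous_on UNIV g'" "g e = 0"
    and \<tau>: "0 \<le> \<tau>" "\<tau> \<le> t" "X \<tau> \<le> e"
  shows "X t \<le> e"
proof (rule ccontr)
  assume "\<not> X t \<le> e"
  then have Xt: "X t > e" by simp
  have cont: "continuous_on {0..t} X" using int by (rule continuous_on_primitive)
  define S where "S = {s\<in>{\<tau>..t}. X s \<le> e}"
  have "compact S"
  proof -
    have "closed ({\<tau>..t} \<inter> X -` {..e})"
      using cont \<tau> by (intro continuous_closed_preimage) (auto elim: continuous_on_subset)
    moreover have "S = {\<tau>..t} \<inter> X -` {..e}" by (auto simp: S_def)
    ultimately show ?thesis by (metis compact_Icc compact_Int_closed inf.left_idem)
  qed
  moreover have "\<tau> \<in> S" using \<tau> by (simp add: S_def)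
  ultimately obtain \<sigma> where \<sigma>: "\<sigma> \<in> S" "\<And>s. s \<in> S \<Longrightarrow> s \<le> \<sigma>"
    using compact_attains_sup[of S] by blast
  have \<sigma>t: "\<tau> \<le> \<sigma>" "\<sigma> < t" "X \<sigma> \<le> e"
    using \<sigma>(1) Xt by (auto simp: S_def less_le)
  have above: "X s > e" if "\<sigma> < s" "s \<le> t" for s
    using \<sigma>(2)[of s] that \<sigma>t by (force simp: S_def)
  have "X \<sigma> = e"
  proof -
    have "\<exists>s\<ge>\<sigma>. s \<le> t \<and> X s = e"
      using \<sigma>t \<tau> Xt by (intro IVT') (auto intro: continuous_on_subset[OF cont])
    then obtain s where "\<sigma> \<le> s" "s \<le> t" "X s = e" by blast
    then show ?thesis using above[of s] by (cases "s = \<sigma>") auto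
  qed
  obtain Q where Q: "\<forall>s\<in>{\<sigma>..t}. X s \<le> Q"
    using continuous_attains_sup[of "{\<sigma>..t}" X] continuous_on_subset[OF cont, of "{\<sigma>..t}"] \<sigma>t \<tau>
    by fastforce
  obtain K where K: "K > 0" "\<forall>y\<in>{e..Q}. \<bar>g' y\<bar> \<le> K"
  proof -
    have "bounded (g' ` {e..Q})"
      by (intro compact_imp_bounded compact_continuous_image continuous_on_subset[OF g(2)]) auto
    then show ?thesis using that by (auto simp: bounded_pos)
  qed
  have g_le: "g y \<le> K * (y - e)" if y: "y \<in> {e..Q}" for y
  proof (cases "y = e")
    case False
    then have "e < y" using y by simp
    then obtain z where z: "e < z" "z < y" "g y - g e = (y - e) * g' z"
      using MVT2[of e y g g'] g(1) by auto
    have "g' z \<le> K" using K(2)[rule_format, of z] z y by auto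
    then have "(y - e) * g' z \<le> (y - e) * K" using \<open>e < y\<close> by (intro mult_left_mono) auto
    then show ?thesis using z(3) g(3) by (simp add: mult.commute)
  qed (simp add: g(3))
  define r where "r = min t (\<sigma> + 1 / (2 * K))"
  have r: "\<sigma> < r" "r \<le> t" "K * (r - \<sigma>) \<le> 1 / 2"
  proof -
    show "\<sigma> < r" "r \<le> t" using \<sigma>t K by (auto simp: r_def)
    have "r - \<sigma> \<le> 1 / (2 * K)" by (simp add: r_def)
    then have "K * (r - \<sigma>) \<le> K * (1 / (2 * K))" using K by (intro mult_left_mono) auto
    then show "K * (r - \<sigma>) \<le> 1 / 2" using K by simp
  qed
  obtain s where s: "s \<in> {\<sigma>..r}" "\<And>q. q \<in> {\<sigma>..r} \<Longrightarrow> X q \<le> X s"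
    using continuous_attains_sup[of "{\<sigma>..r}" X] continuous_on_subset[OF cont, of "{\<sigma>..r}"] \<sigma>t \<tau> r
    by fastforce
  define m where "m = X s - e"
  have m: "m > 0" using s(2)[of r] above[of r] r by (auto simp: m_def)
  have "m \<le> K * m * (s - \<sigma>)"
  proof (rule has_integral_le)
    show "(v has_integral m) {\<sigma>..s}"
      using has_integral_increment[of s v X x \<sigma>] int \<sigma>t \<tau> s(1) \<open>X \<sigma> = e\<close> by (auto simp: m_def)
    show "((\<lambda>_. K * m) has_integral K * m * (s - \<sigma>)) {\<sigma>..s}"
      using has_integral_const_real[of "K * m" \<sigma> s] s(1) by (simp add: mult.commute)
    fix q assume q: "q \<in> {\<sigma>..s}"
    have "v q \<le> g (X q)" using v[of q] q \<sigma>t \<tau> by auto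
    also have "\<dots> \<le> K * (X q - e)"
    proof (rule g_le)
      have "X q \<ge> e" using above[of q] \<open>X \<sigma> = e\<close> q s(1) r by (cases "q = \<sigma>") auto
      then show "X q \<in> {e..Q}" using Q q s(1) r by auto
    qed
    also have "\<dots> \<le> K * m"
      using s(2)[of q] q s(1) K by (intro mult_left_mono) (auto simp: m_def)
    finally show "v q \<le> K * m" .
  qed
  also have "\<dots> = K * (s - \<sigma>) * m" by simp
  also have "\<dots> \<le> 1 / 2 * m"
  proof (intro mult_right_mono)
    have "K * (s - \<sigma>) \<le> K * (r - \<sigma>)" using s(1) K by (intro mult_left_mono) auto
    then show "K * (s - \<sigma>) \<le> 1 / 2" using r(3) by linarith
  qed (use m in auto)
  finally show False using m by simp
qed

text \<open>
  Up to the exit time \<open>\<tau>\<close> the path solves the clamped equation itself.  Afterwards \<open>W\<close> is frozen at its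
  value at the exit point \<open>e\<close>: the integral of \<open>c (\<sigma> s) - W e\<close> keeps its sign, so the continued path
  stays where \<open>W\<close> has that value.
\<close>
lemma (in opposing_drifts) ex_clamped_path:
  fixes V V' X :: "real \<Rightarrow> real" and \<sigma> :: "real \<Rightarrow> nat"
  assumes V: "\<And>y. (V has_real_derivative V' y) (at y)" "continuous_on UNIV V'"
    and VW: "\<And>y. y \<in> {\<alpha>..\<beta>} \<Longrightarrow> V y = W y"
    and states: "\<And>t. t \<ge> 0 \<Longrightarrow> \<sigma> t \<in> {0, 1}"
    and X: "\<And>t. t \<ge> 0 \<Longrightarrow> ((\<lambda>s. c (\<sigma> s) - V (X s)) has_integral (X t - x)) {0..t}"
    and x: "x \<in> {\<alpha><..<\<beta>}"
  shows "\<exists>Z. (\<forall>t\<ge>0. ((\<lambda>s. drift (\<sigma> s) (Z s)) has_integral (Z t - x)) {0..t}) \<and>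
    (\<forall>s t. 0 \<le> s \<longrightarrow> s \<le> t \<longrightarrow> Z s \<ge> \<beta> \<longrightarrow> Z t \<ge> \<beta>) \<and>
    ((\<exists>t>0. X t = \<beta>) \<longleftrightarrow> (\<exists>t\<ge>0. Z t \<ge> \<beta>))"
proof (cases "\<forall>t\<ge>0. X t \<in> {\<alpha><..<\<beta>}")
  case True
  have "((\<lambda>s. drift (\<sigma> s) (X s)) has_integral (X t - x)) {0..t}" if "t \<ge> 0" for t
    using X[OF that] by (rule has_integral_eq[rotated]) (use True VW in \<open>auto simp: drift_def\<close>)
  moreover have "\<not> X t \<ge> \<beta>" if "t \<ge> 0" for t using True that by force
  ultimately show ?thesis by (intro exI[of _ X]) (metis less_eq_real_def order_refl)
next
  case False
  then obtain t0 where t0: "t0 \<ge> 0" "X t0 \<notin> {\<alpha><..<\<beta>}" by blast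
  have cont: "continuous_on {0..t} X" for t using X by (rule continuous_on_primitive)
  have X0: "X 0 = x"
    using has_integral_unique[OF X[of 0], of 0] by (simp add: has_integral_refl)
  define A where "A = {0..t0} \<inter> X -` ({..\<alpha>} \<union> {\<beta>..})"
  have "closed A" unfolding A_def by (intro continuous_closed_preimage cont closed_Un) auto
  then have "compact A" unfolding A_def by (metis compact_Icc compact_Int_closed inf.left_idem)
  moreover have "t0 \<in> A" using t0 by (auto simp: A_def)
  ultimately obtain \<tau> where \<tau>: "\<tau> \<in> A" "\<And>s. s \<in> A \<Longrightarrow> \<tau> \<le> s"
    using compact_attains_inf[of A] by blast
  have before: "X s \<in> {\<alpha><..<\<beta>}" if "0 \<le> s" "s < \<tau>" for s
    using \<tau>(2)[of s] \<tau>(1) that by (force simp: A_def)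
  have "\<tau> \<noteq> 0" using \<tau>(1) X0 x by (auto simp: A_def)
  then have \<tau>0: "\<tau> > 0" using \<tau>(1) by (auto simp: A_def)
  have exit_point: "X \<tau> = \<alpha> \<or> X \<tau> = \<beta>"
  proof -
    consider "X \<tau> \<le> \<alpha>" | "X \<tau> \<ge> \<beta>" using \<tau>(1) by (auto simp: A_def)
    then show ?thesis
    proof cases
      case 1
      then have "\<exists>s\<ge>0. s \<le> \<tau> \<and> X s = \<alpha>"
        using \<tau>0 X0 x by (intro IVT2') (auto intro: cont)
      then obtain s where "0 \<le> s" "s \<le> \<tau>" "X s = \<alpha>" by blast
      then show ?thesis using before[of s] by (cases "s = \<tau>") auto
    next
      case 2
      then have "\<exists>s\<ge>0. s \<le> \<tau> \<and> X s = \<beta>"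
        using \<tau>0 X0 x by (intro IVT') (auto intro: cont)
      then obtain s where "0 \<le> s" "s \<le> \<tau>" "X s = \<beta>" by blast
      then show ?thesis using before[of s] by (cases "s = \<tau>") auto
    qed
  qed
  define e where "e = X \<tau>"
  have e_cases: "e = \<alpha> \<or> e = \<beta>" using exit_point by (simp add: e_def)
  define Z where "Z t = (if t \<le> \<tau> then X t else e + integral {\<tau>..t} (\<lambda>s. c (\<sigma> s) - W e))" for t
  have c_int: "(\<lambda>s. c (\<sigma> s) - W e) integrable_on {\<tau>..t}" if "t \<ge> \<tau>" for t
  proof -
    have "isCont V y" for y using V(1) DERIV_isCont by blast
    then have cont_V: "continuous_on {0..t} (\<lambda>s. V (X s))"
      by (intro continuous_on_compose2[OF _ cont, of UNIV]) (auto simp: continuous_at_imp_continuous_on)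
    have "(\<lambda>s. c (\<sigma> s) - V (X s)) integrable_on {0..t}"
      using X[of t] that \<tau>0 by auto
    then have "(\<lambda>s. (c (\<sigma> s) - V (X s)) + V (X s)) integrable_on {0..t}"
      by (rule integrable_add[OF _ integrable_continuous_real[OF cont_V]])
    then have "(\<lambda>s. c (\<sigma> s)) integrable_on {0..t}" by simp
    then have "(\<lambda>s. c (\<sigma> s) - W e) integrable_on {0..t}"
      by (rule integrable_diff) (rule integrable_const_ivl)
    then show ?thesis using that \<tau>0 by (elim integrable_subinterval_real) auto
  qed
  have Z_int: "((\<lambda>s. c (\<sigma> s) - W e) has_integral (Z t - e)) {\<tau>..t}" if "t \<ge> \<tau>" for t
  proof (cases "t = \<tau>")
    case True
    then show ?thesis by (simp add: Z_def e_def has_integral_refl)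
  next
    case False
    then show ?thesis using integrable_integral[OF c_int[OF that]] that by (simp add: Z_def)
  qed
  have after_right: "Z t \<ge> \<beta>" if "e = \<beta>" "t \<ge> \<tau>" for t
  proof -
    have "0 \<le> Z t - e"
    proof (rule has_integral_nonneg[OF Z_int[OF that(2)]])
      show "0 \<le> c (\<sigma> s) - W e" if "s \<in> {\<tau>..t}" for s
        using states[of s] that \<tau>0 \<open>e = \<beta>\<close> W_right[of \<beta>] c_order by auto
    qed
    then show ?thesis using that by simp
  qed
  have after_left: "Z t \<le> \<alpha>" if "e = \<alpha>" "t \<ge> \<tau>" for t
  proof -
    have "Z t - e \<le> 0"
    proof (rule has_integral_le[OF Z_int[OF that(2)] has_integral_0])
      show "c (\<sigma> s) - W e \<le> 0" if "s \<in> {\<tau>..t}" for s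
        using states[of s] that \<tau>0 \<open>e = \<alpha>\<close> W_left[of \<alpha>] c_order by auto
    qed
    then show ?thesis using that by simp
  qed
  have W_const: "W (Z t) = W e" if "t \<ge> \<tau>" for t
    using e_cases after_left[OF _ that] after_right[OF _ that] W_left W_right by (metis order_refl)
  have Z_solves: "((\<lambda>s. drift (\<sigma> s) (Z s)) has_integral (Z t - x)) {0..t}" if "t \<ge> 0" for t
  proof -
    have first: "((\<lambda>s. drift (\<sigma> s) (Z s)) has_integral (Z t - x)) {0..t}" if t: "0 \<le> t" "t \<le> \<tau>" for t
    proof -
      have "((\<lambda>s. drift (\<sigma> s) (Z s)) has_integral (X t - x)) {0..t}"
      proof (rule has_integral_eq[OF _ X[OF t(1)]])
        fix s assume s: "s \<in> {0..t}"
        have "X s \<in> {\<alpha>..\<beta>}"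
          using before[of s] e_cases ends s t by (cases "s = \<tau>") (auto simp: e_def)
        then show "c (\<sigma> s) - V (X s) = drift (\<sigma> s) (Z s)"
          using VW s t by (simp add: drift_def Z_def)
      qed
      then show ?thesis using t by (simp add: Z_def)
    qed
    show ?thesis
    proof (cases "t \<le> \<tau>")
      case True
      then show ?thesis using first that by simp
    next
      case False
      have "((\<lambda>s. drift (\<sigma> s) (Z s)) has_integral (Z \<tau> - x) + (Z t - e)) {0..t}"
      proof (rule has_integral_combine[of 0 \<tau> t])
        show "((\<lambda>s. drift (\<sigma> s) (Z s)) has_integral (Z \<tau> - x)) {0..\<tau>}" using first \<tau>0 by simp
        show "((\<lambda>s. drift (\<sigma> s) (Z s)) has_integral (Z t - e)) {\<tau>..t}"
          using Z_int[of t] by (rule has_integral_eq[rotated]) (use W_const False in \<open>auto simp: drift_def\<close>)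
      qed (use \<tau>0 False in auto)
      then show ?thesis by (simp add: Z_def e_def)
    qed
  qed
  have "Z s < \<beta>" if "0 \<le> s" "s < \<tau>" for s
    using before[OF that] that by (simp add: Z_def)
  then have Z_hit: "Z s \<ge> \<beta> \<longleftrightarrow> e = \<beta> \<and> s \<ge> \<tau>" if "0 \<le> s" for s
    using that e_cases after_left[of s] after_right[of s] ends by (cases "s < \<tau>") force+
  have X_hit: "(\<exists>t>0. X t = \<beta>) \<longleftrightarrow> e = \<beta>"
  proof
    assume "e = \<beta>"
    then show "\<exists>t>0. X t = \<beta>" using \<tau>0 by (auto simp: e_def)
  next
    assume "\<exists>t>0. X t = \<beta>"
    then obtain t where t: "t > 0" "X t = \<beta>" by blast
    then have "t \<ge> \<tau>" using before[of t] by force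
    show "e = \<beta>"
    proof (rule ccontr)
      assume "e \<noteq> \<beta>"
      then have "X \<tau> \<le> \<alpha>" using e_cases by (simp add: e_def)
      have "X t \<le> \<alpha>"
      proof (rule stays_below_equilibrium[where X = X and v = "\<lambda>s. c (\<sigma> s) - V (X s)" and x = x and \<tau> = \<tau>
            and g = "\<lambda>y. c 0 - V y" and g' = "\<lambda>y. - V' y"])
        show "c (\<sigma> s) - V (X s) \<le> c 0 - V (X s)" if "s \<ge> 0" for s
          using states[OF that] c_order by auto
        show "((\<lambda>y. c 0 - V y) has_real_derivative - V' y) (at y)" for y
          by (auto intro!: derivative_eq_intros V(1))
        show "c 0 - V \<alpha> = 0" using VW[of \<alpha>] W_left[of \<alpha>] ends by simp
      qed (use X V(2) \<open>\<tau> \<le> t\<close> \<tau>0 \<open>X \<tau> \<le> \<alpha>\<close> in \<open>auto intro!: continuous_intros\<close>)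
      then show False using t(2) ends by simp
    qed
  qed
  show ?thesis
  proof (intro exI[of _ Z] conjI allI impI)
    show "Z t \<ge> \<beta>" if "0 \<le> s" "s \<le> t" "Z s \<ge> \<beta>" for s t
      using that Z_hit[of s] Z_hit[of t] by auto
    show "(\<exists>t>0. X t = \<beta>) \<longleftrightarrow> (\<exists>t\<ge>0. Z t \<ge> \<beta>)"
      unfolding X_hit using Z_hit \<tau>0 by (metis less_imp_le order_refl)
  qed (rule Z_solves)
qed

lemma markov_step_probability:
  fixes \<xi> :: "real \<Rightarrow> 'w \<Rightarrow> nat"
  assumes M: "prob_space M"
    and meas: "\<And>t. t \<ge> 0 \<Longrightarrow> \<xi> t \<in> measurable M (count_space UNIV)"
    and cond: "\<And>(n::nat) (t :: nat \<Rightarrow> real) (s :: nat \<Rightarrow> nat) h j. j \<in> {0, 1} \<Longrightarrow>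
           0 \<le> t 0 \<and> (\<forall>k<n. t k < t (Suc k)) \<and> h \<ge> 0 \<and>
           \<P>(\<omega> in M. \<forall>k\<le>n. \<xi> (t k) \<omega> = s k) > 0 \<Longrightarrow>
           \<P>(\<omega> in M. \<xi> (t n + h) \<omega> = j \<bar> \<forall>k\<le>n. \<xi> (t k) \<omega> = s k) = p (s n) j h"
    and "h > 0" "j \<in> {0, 1}"
  shows "measure M {\<omega>\<in>space M. (\<forall>k\<le>n. \<xi> (real k * h) \<omega> = s k) \<and> \<xi> (real (Suc n) * h) \<omega> = j}
      = p (s n) j h * measure M {\<omega>\<in>space M. \<forall>k\<le>n. \<xi> (real k * h) \<omega> = s k}"
proof -
  interpret prob_space M by (rule M)
  let ?H = "{\<omega>\<in>space M. \<forall>k\<le>n. \<xi> (real k * h) \<omega> = s k}"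
  let ?J = "{\<omega>\<in>space M. (\<forall>k\<le>n. \<xi> (real k * h) \<omega> = s k) \<and> \<xi> (real (Suc n) * h) \<omega> = j}"
  have "{\<omega>\<in>space M. \<xi> (real k * h) \<omega> = s k} \<in> sets M" for k
    using measurable_sets[OF meas, of "real k * h" "{s k}"] \<open>h > 0\<close>
    by (simp add: vimage_def Int_def conj_commute)
  then have "{\<omega>\<in>space M. \<forall>k\<in>{..n}. \<xi> (real k * h) \<omega> = s k} \<in> sets M"
    by (intro sets.sets_Collect_finite_All) auto
  then have H: "?H \<in> sets M" by (simp only: Ball_def atMost_iff)
  show ?thesis
  proof (cases "prob ?H > 0")
    case True
    have "\<P>(\<omega> in M. \<xi> (real n * h + h) \<omega> = j \<bar> \<forall>k\<le>n. \<xi> (real k * h) \<omega> = s k) = p (s n) j h"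
      using cond[OF \<open>j \<in> {0, 1}\<close>, of "\<lambda>k. real k * h" n h s] True \<open>h > 0\<close> by simp
    moreover have "real n * h + h = real (Suc n) * h" by (simp add: algebra_simps)
    moreover have "{\<omega>\<in>space M. \<xi> (real (Suc n) * h) \<omega> = j \<and> (\<forall>k\<le>n. \<xi> (real k * h) \<omega> = s k)} = ?J" by blast
    ultimately have "prob ?J / prob ?H = p (s n) j h" by (simp only: cond_prob_def)
    then show ?thesis using True by (simp only: divide_eq_eq split: if_splits)
  next
    case False
    then have "prob ?H = 0" using measure_nonneg[of M ?H] by linarith
    moreover have "prob ?J \<le> prob ?H" by (rule finite_measure_mono[OF _ H]) blast
    ultimately have "prob ?J = 0" using measure_nonneg[of M ?J] by linarith
    then show ?thesis using \<open>prob ?H = 0\<close> by (simp only: mult_zero_right)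
  qed
qed

section \<open>The probability of reaching the right end\<close>

theorem theorem3p3:
  fixes U :: "real \<Rightarrow> real"
    and xm x0 xp V v am a0 ap bm b0 bp x :: real
    and c l B :: "nat \<Rightarrow> real"
    and M :: "'w measure"
    and \<xi> :: "real \<Rightarrow> 'w \<Rightarrow> nat"
    and X :: "real \<Rightarrow> 'w \<Rightarrow> real"
    and \<Phi> :: "nat \<Rightarrow> real \<Rightarrow> real"
  assumes dw: "double_well U xm x0 xp"
    and V: "{deriv U z | z. local_max_at (deriv U) z} = {V}"
    and v: "{deriv U z | z. local_min_at (deriv U) z} = {v}"
    and order: "V > c 0" "c 0 > c 1" "c 1 > v"
    and div: "\<And>i z. i \<in> {0, 1} \<Longrightarrow> deriv U z = c i \<Longrightarrow>
                reciprocal_integral_diverges_at (\<lambda>y. deriv U y - c i) z"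
    and crit1: "{z. deriv U z = c 1} = {am, a0, ap}"
    and crit0: "{z. deriv U z = c 0} = {bm, b0, bp}"
    and crit_order: "am < bm" "bm < b0" "b0 < a0" "a0 < ap" "ap < bp"
    and l_pos: "l 0 > 0" "l 1 > 0"
    and M: "prob_space M"
    and markov: "two_state_markov M \<xi> l"
    and x: "x \<in> {b0<..<a0}"
    and X: "solves_switched_ode M \<xi> c U x X"
    and \<Phi>: "\<And>i y. i \<in> {0, 1} \<Longrightarrow> y \<in> {b0<..<a0} \<Longrightarrow>
               (\<Phi> i has_real_derivative 1 / (c i - deriv U y)) (at y)"
    and B: "\<And>i. i \<in> {0, 1} \<Longrightarrow>
               B i = (LBINT y=b0..a0. exp (l 0 * \<Phi> 0 y + l 1 * \<Phi> 1 y) / (c i - deriv U y))"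
  shows "(\<P>(\<omega> in M. \<xi> 0 \<omega> = 0) > 0 \<longrightarrow>
           \<P>(\<omega> in M. hitting_time X a0 \<omega> < \<infinity> \<bar> \<xi> 0 \<omega> = 0) =
           1 - inverse (B 0) *
             (LBINT y=x..a0. exp (l 0 * \<Phi> 0 y + l 1 * \<Phi> 1 y) / (c 0 - deriv U y))) \<and>
         (\<P>(\<omega> in M. \<xi> 0 \<omega> = 1) > 0 \<longrightarrow>
           \<P>(\<omega> in M. hitting_time X a0 \<omega> < \<infinity> \<bar> \<xi> 0 \<omega> = 1) =
           inverse (B 1) *
             (LBINT y=b0..x. exp (l 0 * \<Phi> 0 y + l 1 * \<Phi> 1 y) / (c 1 - deriv U y)))"
proof -
  define W where "W y = deriv U (max b0 (min y a0))" for y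
  have C2: "\<And>y. (deriv U has_real_derivative deriv (deriv U) y) (at y)" "continuous_on UNIV (deriv (deriv U))"
    using dw by (auto simp: double_well_def C2_def DERIV_deriv_iff_real_differentiable)
  have contU': "continuous_on S (deriv U)" for S
    using C2(1) DERIV_isCont by (blast intro: continuous_at_imp_continuous_on)
  have U'_eq1: "deriv U z = c 1 \<longleftrightarrow> z \<in> {am, a0, ap}" for z
    using crit1 by (simp add: set_eq_iff)
  have U'_eq0: "deriv U z = c 0 \<longleftrightarrow> z \<in> {bm, b0, bp}" for z
    using crit0 by (simp add: set_eq_iff)
  have between: "c 1 < deriv U y \<and> deriv U y < c 0" if y: "b0 < y" "y < a0" for y
  proof (rule ccontr)
    assume "\<not> (c 1 < deriv U y \<and> deriv U y < c 0)"
    then consider "deriv U y \<le> c 1" | "deriv U y \<ge> c 0" by linarith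
    then show False
    proof cases
      case 1
      then have "\<exists>z\<ge>b0. z \<le> y \<and> deriv U z = c 1"
        using U'_eq0[of b0] order y by (intro IVT2' contU') auto
      then show False using U'_eq1 crit_order y by auto
    next
      case 2
      then have "\<exists>z\<ge>y. z \<le> a0 \<and> deriv U z = c 0"
        using U'_eq1[of a0] order y by (intro IVT2' contU') auto
      then show False using U'_eq0 crit_order y by auto
    qed
  qed
  obtain L where L: "\<forall>y\<in>{b0..a0}. \<bar>deriv (deriv U) y\<bar> \<le> L"
  proof -
    have "bounded (deriv (deriv U) ` {b0..a0})"
      by (intro compact_imp_bounded compact_continuous_image continuous_on_subset[OF C2(2)]) auto
    then show ?thesis using that by (auto simp: bounded_iff)
  qed
  have lip: "\<bar>deriv U y - deriv U z\<bar> \<le> L * \<bar>y - z\<bar>" if "y \<in> {b0..a0}" "z \<in> {b0..a0}" for y z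
  proof -
    have "norm (deriv U y - deriv U z) \<le> L * norm (y - z)"
      by (rule field_differentiable_bound[of "{b0..a0}" _ "deriv (deriv U)"])
         (use that L C2(1) in \<open>auto intro: has_field_derivative_at_within\<close>)
    then show ?thesis by simp
  qed
  interpret opposing_drifts W c l L b0 a0
  proof
    fix y z :: real
    have "\<bar>W y - W z\<bar> \<le> L * \<bar>max b0 (min y a0) - max b0 (min z a0)\<bar>"
      unfolding W_def using crit_order by (intro lip) auto
    also have "\<dots> \<le> L * \<bar>y - z\<bar>"
    proof (rule mult_left_mono)
      show "L \<ge> 0" using L[rule_format, of b0] crit_order by auto
    qed (auto simp: max_def min_def)
    finally show "\<bar>W y - W z\<bar> \<le> L * \<bar>y - z\<bar>" .
  qed (use crit_order U'_eq0[of b0] U'_eq1[of a0] between l_pos in \<open>auto simp: W_def max_def min_def\<close>)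
  have W_eq: "W y = deriv U y" if "y \<in> {b0..a0}" for y using that by (auto simp: W_def max_def min_def)
  have drift_eq: "drift i y = c i - deriv U y" if "y \<in> {b0<..<a0}" for i y
    using that W_eq[of y] by (simp add: drift_def)
  obtain E where E: "exp_solutions E"
    "\<And>i y. i \<in> {0, 1} \<Longrightarrow> y \<in> {b0<..<a0} \<Longrightarrow> E i y = exp (l i * \<Phi> i y)"
  proof (rule ex_exp_solutions[of \<Phi>])
    show "(\<Phi> i has_real_derivative 1 / drift i y) (at y)" if "i \<in> {0, 1}" "y \<in> {b0<..<a0}" for i y
      using \<Phi>[OF that] drift_eq[OF that(2)] by simp
  qed (rule that)
  define f where "f i y = exp (l 0 * \<Phi> 0 y + l 1 * \<Phi> 1 y) / (c i - deriv U y)" for i y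
  have f_eq: "E 0 y * E 1 y / drift i y = f i y" if "y \<in> {b0<..<a0}" for i y
    using that E(2)[of 0 y] E(2)[of 1 y] drift_eq[OF that] by (simp add: f_def exp_add)
  have LBINT_eq: "(LBINT y=a..b. E 0 y * E 1 y / drift i y) = (LBINT y=a..b. f i y)"
    if "b0 \<le> a" "a \<le> b" "b \<le> a0" for a b i
    using that by (intro interval_integral_cong f_eq) (auto simp: einterval_def min_def max_def)
  obtain u where u: "\<And>i. i \<in> {0, 1} \<Longrightarrow> continuous_on UNIV (u i)"
    "\<And>i y. i \<in> {0, 1} \<Longrightarrow> y \<le> b0 \<Longrightarrow> u i y = 0"
    "\<And>i y. i \<in> {0, 1} \<Longrightarrow> y \<ge> a0 \<Longrightarrow> u i y = 1"
    "\<And>i y. i \<in> {0, 1} \<Longrightarrow> drift i y \<noteq> 0 \<Longrightarrow>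
       (u i has_real_derivative l i * (u i y - u (1 - i) y) / drift i y) (at y)"
    and u0: "u 0 x = 1 - inverse (LBINT y=b0..a0. f 0 y) * (LBINT y=x..a0. f 0 y)"
    and u1: "u 1 x = inverse (LBINT y=b0..a0. f 1 y) * (LBINT y=b0..x. f 1 y)"
  proof -
    have ord: "b0 \<le> x" "x \<le> a0" "b0 \<le> a0" using x by auto
    have *: "(LBINT y=b0..a0. E 0 y * E 1 y / drift i y) = (LBINT y=b0..a0. f i y)"
      "(LBINT y=x..a0. E 0 y * E 1 y / drift i y) = (LBINT y=x..a0. f i y)"
      "(LBINT y=b0..x. E 0 y * E 1 y / drift i y) = (LBINT y=b0..x. f i y)" for i
      by (rule LBINT_eq; use ord in simp)+
    show ?thesis
      by (rule ex_exit_function[OF E(1) x]) (rule that, assumption+, simp_all only: *)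
  qed
  obtain p :: "nat \<Rightarrow> nat \<Rightarrow> real \<Rightarrow> real" where p:
    "\<forall>i\<in>{0, 1}. \<forall>h\<ge>0. p i 0 h \<ge> 0 \<and> p i 1 h \<ge> 0 \<and> p i 0 h + p i 1 h = 1"
    "\<forall>(n::nat) (t :: nat \<Rightarrow> real) (s :: nat \<Rightarrow> nat) h. \<forall>j\<in>{0, 1}.
       0 \<le> t 0 \<and> (\<forall>k<n. t k < t (Suc k)) \<and> h \<ge> 0 \<and>
       \<P>(\<omega> in M. \<forall>k\<le>n. \<xi> (t k) \<omega> = s k) > 0 \<longrightarrow>
       \<P>(\<omega> in M. \<xi> (t n + h) \<omega> = j \<bar> \<forall>k\<le>n. \<xi> (t k) \<omega> = s k) = p (s n) j h"
    "\<forall>i\<in>{0, 1}. ((\<lambda>h. p i (1 - i) h / h) \<longlongrightarrow> l i) (at_right 0)"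
    using markov unfolding two_state_markov_def by (elim conjE exE) (rule that, assumption+)
  note process = markov[unfolded two_state_markov_def]
  have \<xi>: "\<And>t. t \<ge> 0 \<Longrightarrow> \<xi> t \<in> measurable M (count_space UNIV)"
    "\<And>t \<omega>. t \<ge> 0 \<Longrightarrow> \<omega> \<in> space M \<Longrightarrow> \<xi> t \<omega> \<in> {0, 1}"
    "\<And>\<omega> t. \<omega> \<in> space M \<Longrightarrow> t \<ge> 0 \<Longrightarrow> \<forall>\<^sub>F s in at_right t. \<xi> s \<omega> = \<xi> t \<omega>"
    "\<And>\<omega> t. \<omega> \<in> space M \<Longrightarrow> t > 0 \<Longrightarrow> \<exists>j. \<forall>\<^sub>F s in at_left t. \<xi> s \<omega> = j"
    using process[THEN conjunct1] process[THEN conjunct2, THEN conjunct1]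
      process[THEN conjunct2, THEN conjunct2, THEN conjunct1]
      process[THEN conjunct2, THEN conjunct2, THEN conjunct2, THEN conjunct1]
    by blast+
  have X_int: "((\<lambda>s. c (\<xi> s \<omega>) - deriv U (X s \<omega>)) has_integral (X t \<omega> - x)) {0..t}"
    if "\<omega> \<in> space M" "t \<ge> 0" for \<omega> t
    using X that unfolding solves_switched_ode_def by blast
  have "\<forall>\<omega>\<in>space M. \<exists>Z. (\<forall>t\<ge>0. ((\<lambda>s. drift (\<xi> s \<omega>) (Z s)) has_integral (Z t - x)) {0..t}) \<and>
    (\<forall>s t. 0 \<le> s \<longrightarrow> s \<le> t \<longrightarrow> Z s \<ge> a0 \<longrightarrow> Z t \<ge> a0) \<and>
    ((\<exists>t>0. X t \<omega> = a0) \<longleftrightarrow> (\<exists>t\<ge>0. Z t \<ge> a0))"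
    by (intro ballI ex_clamped_path[OF C2 W_eq[symmetric]] \<xi>(2) X_int x)
  from bchoice[OF this] obtain Z where Z: "\<forall>\<omega>\<in>space M.
    (\<forall>t\<ge>0. ((\<lambda>s. drift (\<xi> s \<omega>) (Z \<omega> s)) has_integral (Z \<omega> t - x)) {0..t}) \<and>
    (\<forall>s t. 0 \<le> s \<longrightarrow> s \<le> t \<longrightarrow> Z \<omega> s \<ge> a0 \<longrightarrow> Z \<omega> t \<ge> a0) \<and>
    ((\<exists>t>0. X t \<omega> = a0) \<longleftrightarrow> (\<exists>t\<ge>0. Z \<omega> t \<ge> a0))"
    by (elim exE) (rule that)
  interpret prob_space M by (rule M)
  interpret switched_process W c l L b0 a0 p M \<xi> x "\<lambda>t \<omega>. Z \<omega> t"
  proof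
    show "prob {\<omega>\<in>space M. (\<forall>k\<le>n. \<xi> (real k * h) \<omega> = s k) \<and> \<xi> (real (Suc n) * h) \<omega> = j}
      = p (s n) j h * prob {\<omega>\<in>space M. \<forall>k\<le>n. \<xi> (real k * h) \<omega> = s k}"
      if "h > 0" "j \<in> {0, 1}" for h j n s
    proof (rule markov_step_probability[OF M \<xi>(1) _ that])
      show "\<P>(\<omega> in M. \<xi> (t n + h) \<omega> = j \<bar> \<forall>k\<le>n. \<xi> (t k) \<omega> = s k) = p (s n) j h"
        if "j \<in> {0, 1}" "0 \<le> t 0 \<and> (\<forall>k<n. t k < t (Suc k)) \<and> h \<ge> 0 \<and>
          \<P>(\<omega> in M. \<forall>k\<le>n. \<xi> (t k) \<omega> = s k) > 0"
        for n :: nat and t :: "nat \<Rightarrow> real" and s :: "nat \<Rightarrow> nat" and h j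
        by (rule p(2)[THEN spec, THEN spec, THEN spec, THEN spec, THEN bspec, THEN mp, OF that])
    qed
    show "p i 0 h \<ge> 0 \<and> p i 1 h \<ge> 0 \<and> p i 0 h + p i 1 h = 1" if "i \<in> {0, 1}" "h \<ge> 0" for i h
      using p(1) that by blast
    show "((\<lambda>h. p i (1 - i) h / h) \<longlongrightarrow> l i) (at_right 0)" if "i \<in> {0, 1}" for i
      using p(3) that by (rule bspec)
    show "((\<lambda>r. drift (\<xi> r \<omega>) (Z \<omega> r)) has_integral (Z \<omega> t - x)) {0..t}"
      if "\<omega> \<in> space M" "t \<ge> 0" for \<omega> t
      using Z that by blast
  qed (rule \<xi>; assumption)+
  have hit: "hitting_time X a0 \<omega> < \<infinity> \<longleftrightarrow> (\<exists>t\<ge>0. Z \<omega> t \<ge> a0)" if "\<omega> \<in> space M" for \<omega>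
  proof -
    have "hitting_time X a0 \<omega> < \<infinity> \<longleftrightarrow> (\<exists>t>0. X t \<omega> = a0)"
      unfolding hitting_time_def Inf_less_iff by auto
    then show ?thesis using Z that by blast
  qed
  have absorbed: "Z \<omega> t \<ge> a0" if "\<omega> \<in> space M" "0 \<le> s" "s \<le> t" "Z \<omega> s \<ge> a0" for \<omega> s t
    using bspec[OF Z that(1), THEN conjunct2, THEN conjunct1] that(2-4) by blast
  have main: "\<P>(\<omega> in M. hitting_time X a0 \<omega> < \<infinity> \<bar> \<xi> 0 \<omega> = i) = u i x"
    if i: "i \<in> {0, 1}" and pos: "\<P>(\<omega> in M. \<xi> 0 \<omega> = i) > 0" for i
  proof -
    have "{\<omega>\<in>space M. hitting_time X a0 \<omega> < \<infinity> \<and> \<xi> 0 \<omega> = i}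
        = {\<omega>\<in>space M. \<xi> 0 \<omega> = i \<and> (\<exists>t\<ge>0. Z \<omega> t \<ge> a0)}"
      using hit by blast
    moreover have "prob {\<omega>\<in>space M. \<xi> 0 \<omega> = i \<and> (\<exists>t\<ge>0. Z \<omega> t \<ge> a0)} = u i x * prob {\<omega>\<in>space M. \<xi> 0 \<omega> = i}"
      by (rule exit_probability[OF E(1) u absorbed i])
    ultimately show ?thesis using pos by (simp add: cond_prob_def)
  qed
  show ?thesis
    using main[of 0] main[of 1] u0 u1 B[of 0] B[of 1] unfolding f_def by simp
qed

end
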